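(* Let $A$ be a unital complex Banach algebra with unit $\mathbf 1$. Suppose that a map $\Delta: A \to \mathbb{C}$ (not assumed to be linear or homogeneous) satisfies the conditions (a) $\Delta(0)=0$, (b) $\Delta(x)-\Delta(y) \in \mathbb{T}\,\sigma(x-y)$ for all $x,y \in A$. Then $\Delta$ is complex-linear or conjugate linear, and $\overline{\Delta(\mathbf 1)}\,\Delta$ is multiplicative.
   Context: $\mathbb{T}=\{z\in\mathbb{C}: |z|=1\}$. For $a\in A$, $\sigma(a)$ denotes the spectrum of $a$ in $A$, and $\mathbb{T}\,\sigma(a)=\{tz : t\in\mathbb{T},\ z\in\sigma(a)\}$. Conjugate linear means additive and $\Delta(\lambda a)=\overline{\lambda}\,\Delta(a)$ for $\lambda\in\mathbb{C}$, $a\in A$. $\overline{\Delta(\mathbf 1)}\,\Delta$ is the map $a\mapsto \overline{\Delta(\mathbf 1)}\,\Delta(a)$. *)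

theory Defs
  imports Complex_Main
begin

text \<open>
  Unital complex Banach algebras. The norm is submultiplicative, but \<open>norm 1 = 1\<close> is not required
  (hence \<open>real_normed_algebra\<close> with \<open>ring_1\<close> instead of \<open>real_normed_algebra_1\<close>).
  Note that \<open>ring_1\<close> includes \<open>0 \<noteq> 1\<close>, which excludes the zero algebra; all spectra are empty there.
\<close>

class complex_unital_banach_algebra = real_normed_algebra + ring_1 + banach +
  fixes scaleC :: "complex \<Rightarrow> 'a \<Rightarrow> 'a" (infixr \<open>*\<^sub>C\<close> 75)
  assumes scaleC_add_right: "c *\<^sub>C (x + y) = c *\<^sub>C x + c *\<^sub>C y"
    and scaleC_add_left: "(c + d) *\<^sub>C x = c *\<^sub>C x + d *\<^sub>C x"
    and scaleC_scaleC: "c *\<^sub>C d *\<^sub>C x = (c * d) *\<^sub>C x"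
    and scaleR_scaleC: "r *\<^sub>R x = complex_of_real r *\<^sub>C x"
    and mult_scaleC_left: "(c *\<^sub>C x) * y = c *\<^sub>C (x * y)"
    and mult_scaleC_right: "x * (c *\<^sub>C y) = c *\<^sub>C (x * y)"
    and norm_scaleC: "norm (c *\<^sub>C x) = cmod c * norm x"

definition spectrum :: "'a::complex_unital_banach_algebra \<Rightarrow> complex set"
  where "spectrum a = {z. \<not> (\<exists>b. (z *\<^sub>C 1 - a) * b = 1 \<and> b * (z *\<^sub>C 1 - a) = 1)}"

definition circle_spectrum :: "'a::complex_unital_banach_algebra \<Rightarrow> complex set"
  where "circle_spectrum a = {t * z |t z. cmod t = 1 \<and> z \<in> spectrum a}"

definition complex_linear :: "('a::complex_unital_banach_algebra \<Rightarrow> complex) \<Rightarrow> bool"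
  where "complex_linear f \<longleftrightarrow>
    (\<forall>x y. f (x + y) = f x + f y) \<and> (\<forall>c x. f (c *\<^sub>C x) = c * f x)"

definition conjugate_linear :: "('a::complex_unital_banach_algebra \<Rightarrow> complex) \<Rightarrow> bool"
  where "conjugate_linear f \<longleftrightarrow>
    (\<forall>x y. f (x + y) = f x + f y) \<and> (\<forall>c x. f (c *\<^sub>C x) = cnj c * f x)"

definition multiplicative :: "('a::complex_unital_banach_algebra \<Rightarrow> complex) \<Rightarrow> bool"
  where "multiplicative f \<longleftrightarrow> (\<forall>x y. f (x * y) = f x * f y)"

end

theory Submission
  imports Defs "HOL-Complex_Analysis.Complex_Analysis"
    "HOL-Computational_Algebra.Fundamental_Theorem_Algebra"
begin

text \<open>
  Each \<open>\<lambda> \<mapsto> \<Delta>(y + \<lambda>1)\<close> is an isometry of the plane, and by the Lipschitz bound its linear part does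
  not depend on \<open>y\<close>. After multiplication by a unimodular constant and possibly a conjugation,
  \<open>f(y + \<lambda>1) = f(y) + \<lambda>\<close>; shifting by \<open>w = f(x) - f(y)\<close> then gives \<open>f(x) - f(y) \<in> \<sigma>(x - y)\<close>, so it
  remains to prove the Kowalski-Slodkowski theorem for such spectral maps \<open>f\<close>.

  The spectral maps form a compact set that is invariant under the blow-ups
  \<open>v \<mapsto> n (f(a + v/n) - f(a))\<close>. Instead of Rademacher's theorem, an extremality argument is used: if a
  functional on this set is an average of its values at smaller pieces, then, on a nonempty closed
  invariant subset, it is constant and equal to its maximum. For the functionals \<open>Re (c f(v))\<close> this
  shows that minimal closed invariant sets consist of additive maps, which are characters by the
  argument of Gleason, Kahane and Zelazko. For the integral over a parallelogram in a complex line it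
  then shows that this integral vanishes for all spectral maps, as it vanishes for characters. So the
  spectral maps are affine on complex lines by Liouville's theorem.
\<close>

section \<open>Arithmetic of complex scalars\<close>

lemma scaleC_one: "1 *\<^sub>C x = x"
  using scaleR_scaleC[of 1 x] by simp

lemma scaleC_zero_left: "0 *\<^sub>C x = 0"
  using scaleR_scaleC[of 0 x] by simp

lemma scaleC_zero_right: "c *\<^sub>C (0 :: 'a::complex_unital_banach_algebra) = 0"
  using scaleC_add_right[of c 0 "0 :: 'a"] by simp

lemma scaleC_minus_right: "c *\<^sub>C (- x) = - (c *\<^sub>C x)"
  using scaleC_add_right[of c x "- x"] by (simp add: scaleC_zero_right eq_neg_iff_add_eq_0 add.commute)

lemma scaleC_minus_left: "(- c) *\<^sub>C x = - (c *\<^sub>C x)"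
  using scaleC_add_left[of c "- c" x] by (simp add: scaleC_zero_left eq_neg_iff_add_eq_0 add.commute)

lemma scaleC_diff_right: "c *\<^sub>C (x - y) = c *\<^sub>C x - c *\<^sub>C y"
  using scaleC_add_right[of c x "- y"] by (simp add: scaleC_minus_right)

lemma scaleC_diff_left: "(c - d) *\<^sub>C x = c *\<^sub>C x - d *\<^sub>C x"
  using scaleC_add_left[of c "- d" x] by (simp add: scaleC_minus_left)

lemma scaleC_scaleR: "c *\<^sub>C (r *\<^sub>R x) = (r *\<^sub>R c) *\<^sub>C x"
  by (simp add: scaleR_scaleC scaleC_scaleC scaleR_conv_of_real mult.commute)

section \<open>Invertible elements and the spectrum\<close>

definition invertible_element :: "'a::ring_1 \<Rightarrow> bool"
  where "invertible_element a \<longleftrightarrow> (\<exists>b. a * b = 1 \<and> b * a = 1)"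

lemma in_spectrum_iff: "z \<in> spectrum a \<longleftrightarrow> \<not> invertible_element (z *\<^sub>C 1 - a)"
  by (simp add: spectrum_def invertible_element_def)

lemma invertible_element_one: "invertible_element 1"
  by (auto simp: invertible_element_def)

lemma invertible_element_mult:
  assumes "invertible_element a" "invertible_element b"
  shows "invertible_element (a * b)"
proof -
  obtain a' b' where *: "a * a' = 1" "a' * a = 1" "b * b' = 1" "b' * b = 1"
    using assms by (auto simp: invertible_element_def)
  have "(a * b) * (b' * a') = a * (b * b') * a'" "(b' * a') * (a * b) = b' * (a' * a) * b"
    by (simp_all only: mult.assoc)
  with * show ?thesis
    by (auto simp: invertible_element_def intro!: exI[of _ "b' * a'"])
qed

lemma invertible_element_power: "invertible_element a \<Longrightarrow> invertible_element (a ^ n)"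
  by (induction n) (auto intro: invertible_element_mult invertible_element_one)

lemma invertible_element_scaleC_iff:
  assumes "c \<noteq> 0"
  shows "invertible_element (c *\<^sub>C a) \<longleftrightarrow> invertible_element a"
proof -
  have *: "invertible_element (d *\<^sub>C b)" if "d \<noteq> 0" "invertible_element b" for d and b :: 'a
  proof -
    obtain b' where "b * b' = 1" "b' * b = 1"
      using \<open>invertible_element b\<close> by (auto simp: invertible_element_def)
    then have "(d *\<^sub>C b) * (inverse d *\<^sub>C b') = 1 \<and> (inverse d *\<^sub>C b') * (d *\<^sub>C b) = 1"
      using \<open>d \<noteq> 0\<close> by (simp add: mult_scaleC_left mult_scaleC_right scaleC_scaleC scaleC_one)
    then show ?thesis
      by (auto simp: invertible_element_def)
  qed
  from *[of "inverse c" "c *\<^sub>C a"] *[of c a] assms show ?thesis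
    by (auto simp: scaleC_scaleC scaleC_one)
qed

text \<open>The norm of \<open>1\<close> may exceed \<open>1\<close>; instead of a Neumann series, the one-sided inverses are
  the fixed points of the contractions \<open>b \<mapsto> 1 + x b\<close> and \<open>b \<mapsto> 1 + b x\<close>.\<close>

lemma invertible_element_one_minus:
  fixes x :: "'a::complex_unital_banach_algebra"
  assumes "norm x < 1"
  shows "invertible_element (1 - x)"
proof -
  have "\<exists>!b. 1 + x * b = b"
  proof (rule banach_fix_type[of "norm x"])
    show "\<forall>y z. dist (1 + x * y) (1 + x * z) \<le> norm x * dist y z"
      by (simp add: dist_norm right_diff_distrib[symmetric] norm_mult_ineq)
  qed (use assms in auto)
  then obtain b where "1 + x * b = b"
    by blast
  then have b: "(1 - x) * b = 1"
    by (metis add_diff_cancel_right' left_diff_distrib mult_1_left)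
  have "\<exists>!b. 1 + b * x = b"
  proof (rule banach_fix_type[of "norm x"])
    show "\<forall>y z. dist (1 + y * x) (1 + z * x) \<le> norm x * dist y z"
      using norm_mult_ineq[of "_ - _" x]
      by (simp add: dist_norm left_diff_distrib[symmetric]) (simp add: mult.commute)
  qed (use assms in auto)
  then obtain b' where "1 + b' * x = b'"
    by blast
  then have b': "b' * (1 - x) = 1"
    by (metis add_diff_cancel_right' right_diff_distrib mult_1_right)
  have "b' = b' * ((1 - x) * b)"
    using b by simp
  also have "\<dots> = b"
    by (simp only: mult.assoc[symmetric] b' mult_1_left)
  finally show ?thesis
    using b b' by (auto simp: invertible_element_def)
qed

text \<open>Factoring \<open>z 1 - a = z (1 - a/z)\<close> reduces this to
  \<open>invertible_element_one_minus\<close>.\<close>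

lemma spectrum_norm_le:
  assumes "z \<in> spectrum a"
  shows "cmod z \<le> norm a"
proof (rule ccontr)
  assume *: "\<not> cmod z \<le> norm a"
  then have "z \<noteq> 0"
    by auto
  have "norm (inverse z *\<^sub>C a) = norm a / cmod z"
    by (simp add: norm_scaleC norm_inverse divide_inverse mult.commute)
  then have "norm (inverse z *\<^sub>C a) < 1"
    using * \<open>z \<noteq> 0\<close> by (simp add: divide_less_eq)
  then have "invertible_element (z *\<^sub>C (1 - inverse z *\<^sub>C a))"
    using \<open>z \<noteq> 0\<close> by (simp add: invertible_element_scaleC_iff invertible_element_one_minus)
  then show False
    using assms \<open>z \<noteq> 0\<close> by (simp add: in_spectrum_iff scaleC_diff_right scaleC_scaleC scaleC_one)
qed

text \<open>If \<open>b\<close> inverts \<open>z 1 - a\<close>, then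
  \<open>w 1 - a = (z 1 - a) (1 - (z - w) b)\<close>, and the second factor is invertible for
  \<open>w\<close> near \<open>z\<close>. Closedness lets the spectral condition pass to pointwise
  limits of maps.\<close>

lemma closed_spectrum: "closed (spectrum (a :: 'a::complex_unital_banach_algebra))"
proof -
  have "\<exists>e>0. \<forall>w. dist w z < e \<longrightarrow> w \<notin> spectrum a" if "z \<notin> spectrum a" for z
  proof -
    obtain b where b: "(z *\<^sub>C 1 - a) * b = 1" "b * (z *\<^sub>C 1 - a) = 1"
      using \<open>z \<notin> spectrum a\<close> by (auto simp: spectrum_def)
    have "w \<notin> spectrum a" if "dist w z < 1 / (1 + norm b)" for w
    proof -
      have "cmod (z - w) * (1 + norm b) < 1"
        using that by (simp add: dist_norm norm_minus_commute field_simps add_pos_nonneg)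
      then have "cmod (z - w) * norm b < 1"
        by (rule le_less_trans[rotated]) (simp add: algebra_simps)
      then have "invertible_element (1 - (z - w) *\<^sub>C b)"
        by (intro invertible_element_one_minus) (simp add: norm_scaleC)
      moreover have "invertible_element (z *\<^sub>C 1 - a)"
        using b by (auto simp: invertible_element_def)
      moreover have "(z *\<^sub>C 1 - a) * (1 - (z - w) *\<^sub>C b) = w *\<^sub>C 1 - a"
        using b by (simp add: right_diff_distrib mult_scaleC_right scaleC_diff_left)
      ultimately show ?thesis
        by (metis in_spectrum_iff invertible_element_mult)
    qed
    then show ?thesis
      by (intro exI[of _ "1 / (1 + norm b)"]) (auto simp: add_pos_nonneg)
  qed
  then have "open (- spectrum a)"
    by (auto simp: open_dist)
  then show ?thesis
    by (simp add: closed_def)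
qed

lemma spectrum_scaleC_iff:
  assumes "c \<noteq> 0"
  shows "c * z \<in> spectrum (c *\<^sub>C a) \<longleftrightarrow> z \<in> spectrum a"
proof -
  have "(c * z) *\<^sub>C 1 - c *\<^sub>C a = c *\<^sub>C (z *\<^sub>C 1 - a)"
    by (simp add: scaleC_diff_right scaleC_scaleC)
  then show ?thesis
    using assms by (simp add: in_spectrum_iff invertible_element_scaleC_iff)
qed

lemma in_spectrum_scaleC_one:
  assumes "z \<in> spectrum (c *\<^sub>C (1 :: 'a::complex_unital_banach_algebra))"
  shows "z = c"
proof (rule ccontr)
  assume "z \<noteq> c"
  then have "invertible_element ((z - c) *\<^sub>C (1 :: 'a))"
    by (simp add: invertible_element_scaleC_iff invertible_element_one)
  then show False
    using assms by (simp add: in_spectrum_iff scaleC_diff_left)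
qed

lemma zero_in_spectrum_shift_iff: "0 \<in> spectrum (a - w *\<^sub>C 1) \<longleftrightarrow> w \<in> spectrum a"
  by (simp add: in_spectrum_iff scaleC_zero_left)

lemma zero_in_spectrum_iff: "0 \<in> spectrum a \<longleftrightarrow> \<not> invertible_element a"
proof -
  have "invertible_element ((-1) *\<^sub>C a) \<longleftrightarrow> invertible_element a"
    by (rule invertible_element_scaleC_iff) simp
  then show ?thesis
    by (simp add: in_spectrum_iff scaleC_zero_left scaleC_minus_left scaleC_one)
qed

section \<open>Multiplicativity of spectrum-valued real-linear functionals\<close>

lemma complex_linearD:
  assumes "complex_linear f"
  shows "f (x + y) = f x + f y" "f (c *\<^sub>C x) = c * f x" "f (x - y) = f x - f y" "f 0 = 0"
proof -
  show *: "f (x + y) = f x + f y" "f (c *\<^sub>C x) = c * f x" for x y c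
    using assms by (auto simp: complex_linear_def)
  show "f (x - y) = f x - f y"
    using *(1)[of "x - y" y] by simp
  show "f 0 = 0"
    using *(1)[of 0 0] by simp
qed

text \<open>If \<open>p = \<Prod>(1 - \<lambda>\<^sub>i s)\<close>, then \<open>c\<^sub>1\<^sup>2 - 2 c\<^sub>2 = \<Sum>\<lambda>\<^sub>i\<^sup>2\<close>.\<close>

lemma cmod_power_sum_le:
  fixes p :: "complex poly"
  assumes "degree p \<le> n" "coeff p 0 = 1" "B \<ge> 0"
    and "\<And>s. cmod s * B < 1 \<Longrightarrow> poly p s \<noteq> 0"
  shows "cmod ((coeff p 1)\<^sup>2 - 2 * coeff p 2) \<le> real n * B\<^sup>2"
  using assms
proof (induction n arbitrary: p)
  case 0
  then show ?case
    by (simp add: coeff_eq_0)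
next
  case (Suc n)
  show ?case
  proof (cases "degree p = 0")
    case True
    then show ?thesis
      by (simp add: coeff_eq_0)
  next
    case False
    then obtain s where s: "poly p s = 0"
      by (metis constant_degree fundamental_theorem_of_algebra)
    have "s \<noteq> 0"
      using s Suc.prems(2) by (auto simp: poly_0_coeff_0)
    obtain q' where q': "p = [:- s, 1:] * q'"
      using s by (auto simp: poly_eq_0_iff_dvd)
    \<comment> \<open>Moving \<open>- s\<close> from the linear factor to the cofactor gives both
      constant coefficient 1, as the induction hypothesis needs for \<open>q\<close>.\<close>
    define q where "q = smult (- s) q'"
    define l where "l = 1 / s"
    have "[:- s, 1:] = smult (- s) [:1, - l:]"
      using \<open>s \<noteq> 0\<close> by (simp add: l_def)
    then have p: "p = [:1, - l:] * q"
      by (simp only: q' q_def mult_smult_left mult_smult_right)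
    have "q' \<noteq> 0"
      using q' False by auto
    then have "degree q \<le> n"
      using Suc.prems(1) \<open>s \<noteq> 0\<close> by (simp add: q' q_def degree_mult_eq del: mult_pCons_left)
    have q0: "coeff q 0 = 1"
      using Suc.prems(2) by (simp add: p)
    have q: "cmod ((coeff q 1)\<^sup>2 - 2 * coeff q 2) \<le> real n * B\<^sup>2"
      by (rule Suc.IH) (use \<open>degree q \<le> n\<close> q0 Suc.prems in \<open>auto simp: p\<close>)
    \<comment> \<open>The zero-free region keeps the root away from 0, so its reciprocal
      \<open>l\<close> has modulus at most \<open>B\<close>.\<close>
    have "cmod s * B \<ge> 1"
      using s Suc.prems(4)[of s] by force
    then have "cmod l \<le> B"
      using \<open>s \<noteq> 0\<close> by (simp add: l_def norm_divide field_simps)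
    then have l: "cmod (l\<^sup>2) \<le> B\<^sup>2"
      by (simp add: norm_power power_mono)
    have c: "coeff p 1 = coeff q 1 - l" "coeff p 2 = coeff q 2 - l * coeff q 1"
      by (simp_all add: p q0 coeff_pCons numeral_2_eq_2)
    have "(coeff p 1)\<^sup>2 - 2 * coeff p 2 = l\<^sup>2 + ((coeff q 1)\<^sup>2 - 2 * coeff q 2)"
      unfolding c by (simp add: power2_eq_square algebra_simps)
    then have "cmod ((coeff p 1)\<^sup>2 - 2 * coeff p 2) \<le> B\<^sup>2 + real n * B\<^sup>2"
      by (simp only:) (intro order_trans[OF norm_triangle_ineq] add_mono l q)
    then show ?thesis
      by (simp add: algebra_simps)
  qed
qed

text \<open>For complex-linear \<open>R\<close> this is the polynomial
  \<open>s \<mapsto> R (x^k (1 - s x)^n)\<close>. The recursion expands one factor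
  \<open>1 - s x\<close>; the exponent \<open>k\<close> absorbs the \<open>x\<close> that this
  produces.\<close>

fun binomial_poly :: "('a::complex_unital_banach_algebra \<Rightarrow> complex) \<Rightarrow> 'a \<Rightarrow> nat \<Rightarrow> nat \<Rightarrow> complex poly"
  where
    "binomial_poly R x 0 k = [:R (x ^ k):]"
  | "binomial_poly R x (Suc n) k = binomial_poly R x n k - pCons 0 (binomial_poly R x n (Suc k))"

lemma poly_binomial_poly:
  assumes "complex_linear R"
  shows "poly (binomial_poly R x n k) s = R (x ^ k * (1 - s *\<^sub>C x) ^ n)"
proof (induction n arbitrary: k)
  case (Suc n)
  have "x ^ k * (1 - s *\<^sub>C x) ^ Suc n = (x ^ k * (1 - s *\<^sub>C x)) * (1 - s *\<^sub>C x) ^ n"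
    by (simp add: mult.assoc)
  also have "x ^ k * (1 - s *\<^sub>C x) = x ^ k - s *\<^sub>C (x ^ Suc k)"
    by (simp add: right_diff_distrib mult_scaleC_right power_commutes)
  finally show ?case
    by (simp add: Suc.IH left_diff_distrib mult_scaleC_left complex_linearD[OF assms])
qed auto

lemma degree_binomial_poly: "degree (binomial_poly R x n k) \<le> n"
proof (induction n arbitrary: k)
  case (Suc n)
  show ?case
    unfolding binomial_poly.simps
    by (intro degree_diff_le order_trans[OF degree_pCons_le]) (use Suc in \<open>auto intro: le_SucI\<close>)
qed auto

lemma coeff_binomial_poly_0: "coeff (binomial_poly R x n k) 0 = R (x ^ k)"
  by (induction n arbitrary: k) auto

lemma coeff_binomial_poly_1: "coeff (binomial_poly R x n k) 1 = - of_nat n * R (x ^ Suc k)"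
  by (induction n arbitrary: k)
    (auto simp: coeff_binomial_poly_0 coeff_pCons algebra_simps simp del: power_Suc)

lemma coeff_binomial_poly_2:
  "2 * coeff (binomial_poly R x n k) 2 = of_nat n * (of_nat n - 1) * R (x ^ Suc (Suc k))"
proof (induction n arbitrary: k)
  case (Suc n)
  have *: "coeff (pCons 0 q) 2 = coeff q 1" for q :: "complex poly"
    by (simp add: numeral_2_eq_2)
  have rec: "coeff (binomial_poly R x (Suc n) k) 2 =
      coeff (binomial_poly R x n k) 2 + of_nat n * R (x ^ Suc (Suc k))"
    using coeff_binomial_poly_1[of R x n "Suc k"] by (simp add: * del: power_Suc)
  show ?case
    unfolding rec distrib_left Suc.IH by (simp add: algebra_simps del: power_Suc)
qed (auto simp: numeral_2_eq_2)

text \<open>Apply \<open>cmod_power_sum_le\<close> to \<open>s \<mapsto> R ((1 - s x)^n)\<close>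
  with \<open>B = norm x\<close>. The power sum is \<open>n (n d + R (x x))\<close> with
  \<open>d = (R x)^2 - R (x x)\<close>, but its modulus is at most \<open>n (norm x)^2\<close>;
  letting \<open>n\<close> grow forces \<open>d = 0\<close>.\<close>

lemma square_preserving_if_nonzero_on_powers:
  fixes R :: "'a::complex_unital_banach_algebra \<Rightarrow> complex"
  assumes "complex_linear R" "R 1 = 1"
    and nz: "\<And>s n. cmod s * norm x < 1 \<Longrightarrow> R ((1 - s *\<^sub>C x) ^ n) \<noteq> 0"
  shows "R (x * x) = (R x)\<^sup>2"
proof (rule ccontr)
  define d where "d = (R x)\<^sup>2 - R (x * x)"
  assume "R (x * x) \<noteq> (R x)\<^sup>2"
  then have "cmod d > 0"
    by (simp add: d_def)
  have bound: "real n * cmod d \<le> (norm x)\<^sup>2 + cmod (R (x * x))" if "n > 0" for n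
  proof -
    let ?p = "binomial_poly R x n 0"
    have "cmod ((coeff ?p 1)\<^sup>2 - 2 * coeff ?p 2) \<le> real n * (norm x)\<^sup>2"
      by (rule cmod_power_sum_le)
        (use assms in \<open>auto simp: degree_binomial_poly coeff_binomial_poly_0 poly_binomial_poly\<close>)
    moreover have "(coeff ?p 1)\<^sup>2 - 2 * coeff ?p 2 = of_nat n * (of_nat n * d + R (x * x))"
      by (subst coeff_binomial_poly_1, subst coeff_binomial_poly_2)
        (simp add: d_def power2_eq_square algebra_simps)
    ultimately have "real n * cmod (of_nat n * d + R (x * x)) \<le> real n * (norm x)\<^sup>2"
      by (simp add: norm_mult)
    then have "cmod (of_nat n * d + R (x * x)) \<le> (norm x)\<^sup>2"
      using that by simp
    moreover have "real n * cmod d \<le> cmod (of_nat n * d + R (x * x)) + cmod (R (x * x))"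
      using norm_triangle_ineq4[of "of_nat n * d + R (x * x)" "R (x * x)"] by (simp add: norm_mult)
    ultimately show ?thesis
      by linarith
  qed
  obtain n where n: "real n * cmod d > (norm x)\<^sup>2 + cmod (R (x * x))"
    using \<open>cmod d > 0\<close> reals_Archimedean3 by blast
  have "0 \<le> (norm x)\<^sup>2 + cmod (R (x * x))"
    by simp
  with n have "n > 0"
    by (metis gr0I linorder_not_less mult_zero_left of_nat_0)
  with n bound[of n] show False
    by linarith
qed

text \<open>Polarization gives the Jordan identity. With
  \<open>(xy - yx)^2 + (xy + yx)^2 = 2 (x (yxy) + (yxy) x)\<close> it shows that the kernel absorbs
  right multiplication, which is then applied to \<open>x - R x 1\<close>.\<close>

lemma multiplicative_if_square_preserving:
  fixes R :: "'a::complex_unital_banach_algebra \<Rightarrow> complex"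
  assumes lin: "complex_linear R" and "R 1 = 1" and sq: "\<And>x. R (x * x) = (R x)\<^sup>2"
  shows "multiplicative R"
proof -
  note L = complex_linearD[OF lin]
  have jordan: "R (x * y + y * x) = 2 * R x * R y" for x y
  proof -
    have "(R x + R y)\<^sup>2 = R ((x + y) * (x + y))"
      by (simp only: sq L(1))
    also have "\<dots> = (R x)\<^sup>2 + R (x * y + y * x) + (R y)\<^sup>2"
      by (simp add: algebra_simps L sq[symmetric])
    finally show ?thesis
      by (simp add: power2_eq_square algebra_simps)
  qed
  have zero: "R (x * y) = 0" if "R x = 0" for x y
  proof -
    have "(x * y - y * x) * (x * y - y * x) + (x * y + y * x) * (x * y + y * x) =
        (x * (y * x * y) + (y * x * y) * x) + (x * (y * x * y) + (y * x * y) * x)"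
      by (simp add: algebra_simps)
    then have "R ((x * y - y * x) * (x * y - y * x)) + R ((x * y + y * x) * (x * y + y * x)) =
        R (x * (y * x * y) + (y * x * y) * x) + R (x * (y * x * y) + (y * x * y) * x)"
      by (simp only: L(1)[symmetric])
    also have "\<dots> = 0"
      using that by (simp only: jordan) simp
    finally have "R ((x * y - y * x) * (x * y - y * x)) + R ((x * y + y * x) * (x * y + y * x)) = 0" .
    then have "R (x * y - y * x) = 0"
      using that by (simp only: sq jordan) simp
    then show ?thesis
      using jordan[of x y] that by (simp add: L)
  qed
  have "R (x * y) = R x * R y" for x y
  proof -
    have "R ((x - R x *\<^sub>C 1) * y) = 0"
      by (rule zero) (simp add: L \<open>R 1 = 1\<close>)
    then show ?thesis
      by (simp add: left_diff_distrib mult_scaleC_left L)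
  qed
  then show ?thesis
    by (simp add: multiplicative_def)
qed

definition spectral_maps :: "('a::complex_unital_banach_algebra \<Rightarrow> complex) set"
  where "spectral_maps = {f. f 0 = 0 \<and> (\<forall>x y. f x - f y \<in> spectrum (x - y))}"

lemma spectral_mapsD:
  assumes "f \<in> spectral_maps"
  shows "f 0 = 0" "f x - f y \<in> spectrum (x - y)" "f x \<in> spectrum x"
    "cmod (f x - f y) \<le> norm (x - y)" "cmod (f x) \<le> norm x"
proof -
  show *: "f 0 = 0" "f x - f y \<in> spectrum (x - y)" for x y
    using assms by (auto simp: spectral_maps_def)
  show **: "f x \<in> spectrum x"
    using *(1) *(2)[of x 0] by simp
  show "cmod (f x - f y) \<le> norm (x - y)" "cmod (f x) \<le> norm x"
    using *(2) ** by (auto intro: spectrum_norm_le)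
qed

text \<open>With \<open>n r = m + e\<close>, \<open>m\<close> an integer and
  \<open>|e| \<le> 1\<close>, additivity gives \<open>n (f (r x) - r f x) = f (e x) - e f x\<close>.
  The right side is bounded in \<open>n\<close>, so the defect vanishes.\<close>

lemma additive_bounded_scaleR:
  fixes f :: "'a::real_normed_vector \<Rightarrow> complex"
  assumes add: "\<And>x y. f (x + y) = f x + f y" and bound: "\<And>x. cmod (f x) \<le> norm x"
  shows "f (r *\<^sub>R x) = r *\<^sub>R f x"
proof (rule ccontr)
  have f0: "f 0 = 0"
    using add[of 0 0] by simp
  have minus: "f (- x) = - f x" for x
    using add[of x "- x"] f0 by (simp add: eq_neg_iff_add_eq_0 add.commute)
  have nat: "f (real n *\<^sub>R x) = real n *\<^sub>R f x" for n x
    by (induction n) (simp_all add: f0 add scaleR_left_distrib)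
  have int: "f (of_int m *\<^sub>R x) = of_int m *\<^sub>R f x" for m x
    by (cases m) (use nat[of "nat \<bar>m\<bar>" x] in \<open>auto simp: nat minus simp del: of_nat_Suc\<close>)
  assume "f (r *\<^sub>R x) \<noteq> r *\<^sub>R f x"
  then have "cmod (f (r *\<^sub>R x) - r *\<^sub>R f x) > 0"
    by simp
  then obtain n where n: "real n * cmod (f (r *\<^sub>R x) - r *\<^sub>R f x) > norm x + norm x"
    using reals_Archimedean3 by blast
  define m where "m = \<lfloor>real n * r\<rfloor>"
  define e where "e = real n * r - of_int m"
  have e: "\<bar>e\<bar> \<le> 1"
    unfolding e_def m_def by linarith
  have nr: "real n * r = of_int m + e"
    by (simp add: e_def)
  have "real n *\<^sub>R f (r *\<^sub>R x) = f ((real n * r) *\<^sub>R x)"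
    using nat[of n "r *\<^sub>R x"] by simp
  also have "\<dots> = of_int m *\<^sub>R f x + f (e *\<^sub>R x)"
    by (simp add: nr scaleR_left_distrib add int)
  finally have "real n *\<^sub>R (f (r *\<^sub>R x) - r *\<^sub>R f x) = f (e *\<^sub>R x) - e *\<^sub>R f x"
    by (simp add: scaleR_right_diff_distrib nr scaleR_left_distrib)
  then have "real n * cmod (f (r *\<^sub>R x) - r *\<^sub>R f x) = cmod (f (e *\<^sub>R x) - e *\<^sub>R f x)"
    by (metis norm_scaleR abs_of_nat)
  also have "\<dots> \<le> cmod (f (e *\<^sub>R x)) + cmod (e *\<^sub>R f x)"
    by (rule norm_triangle_ineq4)
  also have "cmod (f (e *\<^sub>R x)) \<le> norm x"
    using bound[of "e *\<^sub>R x"] mult_right_mono[OF e norm_ge_zero[of x]] by simp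
  also have "cmod (e *\<^sub>R f x) \<le> norm x"
    using mult_mono[OF e bound[of x]] by simp
  finally show False
    using n by simp
qed

text \<open>This is the Gleason-Kahane-Zelazko argument with a conjugate-linear part to exclude: the
  maps \<open>R + w T\<close> with \<open>|w| \<le> 1\<close> do not vanish on powers of
  \<open>1 - s x\<close>, so all of them preserve squares.\<close>

lemma additive_spectral_map:
  fixes h :: "'a::complex_unital_banach_algebra \<Rightarrow> complex"
  assumes h: "h \<in> spectral_maps" and add: "\<And>x y. h (x + y) = h x + h y"
  shows "complex_linear h" "multiplicative h"
proof -
  have scale: "h (r *\<^sub>R x) = r *\<^sub>R h x" for r x
    using additive_bounded_scaleR[of h, OF add] spectral_mapsD(5)[OF h] by blast
  have hC: "h (c *\<^sub>C x) = Re c * h x + Im c * h (\<i> *\<^sub>C x)" for c x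
  proof -
    have "c *\<^sub>C x = Re c *\<^sub>R x + Im c *\<^sub>R (\<i> *\<^sub>C x)"
      by (simp add: scaleR_scaleC scaleC_scaleC flip: scaleC_add_left)
        (metis complex_eq mult.commute)
    then show ?thesis
      by (simp add: add scale scaleR_conv_of_real)
  qed
  have one: "h (c *\<^sub>C 1) = c" for c
    using spectral_mapsD(3)[OF h] by (rule in_spectrum_scaleC_one)
  \<comment> \<open>\<open>R\<close> is the complex-linear part of the real-linear \<open>h\<close>;
    \<open>T\<close> is the conjugate of its conjugate-linear part, hence complex-linear
    too.\<close>
  define R where "R x = (h x - \<i> * h (\<i> *\<^sub>C x)) / 2" for x
  define T where "T x = cnj ((h x + \<i> * h (\<i> *\<^sub>C x)) / 2)" for x
  have hRT: "h x = R x + cnj (T x)" for x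
    by (simp add: R_def T_def field_simps)
  have hiC: "h (\<i> *\<^sub>C c *\<^sub>C x) = Re c * h (\<i> *\<^sub>C x) - Im c * h x" for c x
    by (simp add: scaleC_scaleC hC[of "\<i> * c"])
  have "R (c *\<^sub>C x) = c * R x" "T (c *\<^sub>C x) = c * T x" for c x
    unfolding R_def T_def hiC hC[of c x]
    by (simp_all add: complex_eq_iff algebra_simps diff_divide_distrib add_divide_distrib)
  moreover have "R (x + y) = R x + R y" "T (x + y) = T x + T y" for x y
    by (simp_all add: R_def T_def add scaleC_add_right field_simps)
  ultimately have linR: "complex_linear R" and linT: "complex_linear T"
    by (auto simp: complex_linear_def)
  have R1: "R 1 = 1" and T1: "T 1 = 0"
    using one[of 1] one[of \<i>] by (simp_all add: R_def T_def scaleC_one)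

  \<comment> \<open>If the moduli agreed, \<open>h (t y) = t R y + cnj t cnj (T y)\<close> would
    vanish for some unimodular \<open>t\<close>, putting 0 into the spectrum of the invertible
    \<open>t y\<close>.\<close>
  have neq: "cmod (R y) \<noteq> cmod (T y)" if y: "invertible_element y" for y
  proof
    assume eq: "cmod (R y) = cmod (T y)"
    obtain t where t: "cmod t = 1" "t * R y + cnj t * cnj (T y) = 0"
    proof (cases "R y = 0")
      case True
      then show ?thesis
        using eq that[of 1] by simp
    next
      case False
      \<comment> \<open>Since \<open>cnj t = 1 / t\<close>, the equation amounts to
        \<open>t^2 R y = - cnj (T y)\<close>.\<close>
      define t where "t = csqrt (- cnj (T y) / R y)"
      have t2: "t * t * R y = - cnj (T y)"
        using False by (simp add: t_def flip: power2_eq_square)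
      have "cmod t = 1"
        using eq False by (auto simp: t_def norm_divide)
      moreover have "t * (t * R y + cnj t * cnj (T y)) = t * t * R y + (t * cnj t) * cnj (T y)"
        by (simp add: algebra_simps)
      then have "t * (t * R y + cnj t * cnj (T y)) = 0"
        using \<open>cmod t = 1\<close> by (simp add: t2 complex_norm_square[symmetric])
      ultimately show ?thesis
        using that[of t] by auto
    qed
    have "h (t *\<^sub>C y) = t * R y + cnj t * cnj (T y)"
      by (simp add: hRT complex_linearD[OF linR] complex_linearD[OF linT])
    then have "0 \<in> spectrum (t *\<^sub>C y)"
      using t spectral_mapsD(3)[OF h, of "t *\<^sub>C y"] by simp
    moreover have "t \<noteq> 0"
      using t by auto
    ultimately show False
      using y by (simp add: zero_in_spectrum_iff invertible_element_scaleC_iff)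
  qed

  \<comment> \<open>Along the path \<open>u \<mapsto> (1 - u s x)^n\<close> of invertible elements
    the difference \<open>g\<close> of the moduli never vanishes; it is 1 at \<open>u = 0\<close>,
    hence positive at \<open>u = 1\<close>.\<close>
  have less: "cmod (T ((1 - s *\<^sub>C x) ^ n)) < cmod (R ((1 - s *\<^sub>C x) ^ n))"
    if s: "cmod s * norm x < 1" for s x n
  proof -
    define g where "g u = cmod (R ((1 - (of_real u * s) *\<^sub>C x) ^ n))
      - cmod (T ((1 - (of_real u * s) *\<^sub>C x) ^ n))" for u :: real
    have "g = (\<lambda>u. cmod (poly (binomial_poly R x n 0) (of_real u * s))
      - cmod (poly (binomial_poly T x n 0) (of_real u * s)))"
      by (simp add: fun_eq_iff g_def poly_binomial_poly linR linT)
    then have cont: "continuous_on {0..1} g"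
      by (auto intro!: continuous_intros)
    have nz: "g u \<noteq> 0" if "0 \<le> u" "u \<le> 1" for u
    proof -
      have "u * (cmod s * norm x) \<le> 1 * (cmod s * norm x)"
        using that by (intro mult_right_mono) auto
      then have "norm ((of_real u * s) *\<^sub>C x) < 1"
        using s that by (simp add: norm_scaleC norm_mult mult.assoc)
      then show ?thesis
        using neq[OF invertible_element_power[OF invertible_element_one_minus]] by (simp add: g_def)
    qed
    have "g 0 = 1"
      by (simp add: g_def scaleC_zero_left R1 T1)
    have "g 1 > 0"
    proof (rule ccontr)
      assume "\<not> g 1 > 0"
      then obtain u where "0 \<le> u" "u \<le> 1" "g u = 0"
        using IVT2'[of g 1 0 0] cont \<open>g 0 = 1\<close> by auto
      with nz show False
        by blast
    qed
    then show ?thesis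
      by (simp add: g_def)
  qed

  have square: "R (x * x) + w * T (x * x) = (R x + w * T x)\<^sup>2" if w: "cmod w \<le> 1" for w x
  proof (rule square_preserving_if_nonzero_on_powers[of "\<lambda>x. R x + w * T x"])
    show "complex_linear (\<lambda>x. R x + w * T x)"
      by (simp add: complex_linear_def complex_linearD[OF linR] complex_linearD[OF linT] algebra_simps)
    show "R 1 + w * T 1 = 1"
      by (simp add: R1 T1)
    fix s n
    assume "cmod s * norm x < 1"
    then have *: "cmod (T ((1 - s *\<^sub>C x) ^ n)) < cmod (R ((1 - s *\<^sub>C x) ^ n))"
      by (rule less)
    have "cmod (w * T ((1 - s *\<^sub>C x) ^ n)) \<le> 1 * cmod (T ((1 - s *\<^sub>C x) ^ n))"
      unfolding norm_mult using w by (intro mult_right_mono) auto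
    with * show "R ((1 - s *\<^sub>C x) ^ n) + w * T ((1 - s *\<^sub>C x) ^ n) \<noteq> 0"
      by (metis add_eq_0_iff2 linorder_not_less mult_1 norm_minus_cancel)
  qed
  have "T x = 0" for x
  proof -
    \<comment> \<open>Averaging the identities for \<open>w = 1\<close> and \<open>w = -1\<close>
      and subtracting the one for \<open>w = 0\<close> isolates \<open>(T x)^2\<close>.\<close>
    have "(T x)\<^sup>2 = 0"
      using square[of 0 x] square[of 1 x] square[of "-1" x]
      by (simp add: power2_eq_square algebra_simps)
    then show ?thesis
      by simp
  qed
  then have "h = R"
    by (simp add: hRT fun_eq_iff)
  then show "complex_linear h"
    using linR by simp
  show "multiplicative h"
    unfolding \<open>h = R\<close>
    by (rule multiplicative_if_square_preserving) (use linR R1 square[of 0] in auto)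
qed

section \<open>Blow-ups of spectral maps\<close>

lemma closed_spectral_maps: "closed (spectral_maps :: ('a::complex_unital_banach_algebra \<Rightarrow> complex) set)"
proof -
  have "spectral_maps = (\<lambda>f. f 0) -` {0} \<inter> (\<Inter>x :: 'a. \<Inter>y. (\<lambda>f. f x - f y) -` spectrum (x - y))"
    by (auto simp: spectral_maps_def)
  moreover have "closed ((\<lambda>f. f 0) -` {0} \<inter> (\<Inter>x :: 'a. \<Inter>y. (\<lambda>f. f x - f y) -` spectrum (x - y)))"
    by (intro closed_Int closed_INT ballI closed_vimage closed_spectrum closed_singleton
        continuous_on_diff continuous_on_product_coordinates)
  ultimately show ?thesis
    by simp
qed

text \<open>By Tychonoff's theorem, the product of the discs of radius \<open>norm v\<close> is
  compact for pointwise convergence.\<close>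

lemma compact_spectral_maps: "compact (spectral_maps :: ('a::complex_unital_banach_algebra \<Rightarrow> complex) set)"
proof -
  have "compactin (product_topology (\<lambda>_. euclidean) UNIV) (Pi\<^sub>E UNIV (\<lambda>v :: 'a. cball (0 :: complex) (norm v)))"
    by (subst compactin_PiE) simp
  then have "compact (Pi\<^sub>E UNIV (\<lambda>v :: 'a. cball (0 :: complex) (norm v)))"
    by (simp add: euclidean_product_topology)
  moreover have "spectral_maps \<subseteq> Pi\<^sub>E UNIV (\<lambda>v :: 'a. cball (0 :: complex) (norm v))"
    by (auto simp: spectral_mapsD(5))
  ultimately show ?thesis
    using closed_Int_compact[OF closed_spectral_maps] by (metis inf.absorb1)
qed

text \<open>For \<open>n = 1\<close> this is a translation of \<open>f\<close> renormalised to
  vanish at 0; larger \<open>n\<close> zooms in at \<open>a\<close>.\<close>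

definition blowup :: "nat \<Rightarrow> 'a::real_vector \<Rightarrow> ('a \<Rightarrow> complex) \<Rightarrow> 'a \<Rightarrow> complex"
  where "blowup n a f v = of_nat n * (f (a + (1 / real n) *\<^sub>R v) - f a)"

text \<open>In particular, a translation by \<open>a\<close> after a zoom by \<open>k\<close> is a
  translation by \<open>a / k\<close> before it, so a given translation is cheap at fine
  scales.\<close>

lemma blowup_blowup:
  "blowup n a (blowup k b f) = blowup (k * n) (b + (1 / real k) *\<^sub>R a) f"
proof
  fix v
  have e: "b + (1 / real k) *\<^sub>R (a + (1 / real n) *\<^sub>R v) =
      (b + (1 / real k) *\<^sub>R a) + (1 / real (k * n)) *\<^sub>R v"
    by (simp add: scaleR_right_distrib add.assoc)
  show "blowup n a (blowup k b f) v = blowup (k * n) (b + (1 / real k) *\<^sub>R a) f v"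
    unfolding blowup_def e by (simp add: right_diff_distrib mult_ac)
qed

lemma blowup_spectral_maps:
  assumes "f \<in> spectral_maps" "n > 0"
  shows "blowup n a f \<in> spectral_maps"
proof -
  have "blowup n a f v - blowup n a f w \<in> spectrum (v - w)" for v w
  proof -
    have "f (a + (1 / real n) *\<^sub>R v) - f (a + (1 / real n) *\<^sub>R w) \<in> spectrum ((1 / real n) *\<^sub>R (v - w))"
      using spectral_mapsD(2)[OF assms(1), of "a + (1 / real n) *\<^sub>R v" "a + (1 / real n) *\<^sub>R w"]
      by (simp add: scaleR_right_diff_distrib)
    then have "of_nat n * (f (a + (1 / real n) *\<^sub>R v) - f (a + (1 / real n) *\<^sub>R w))
        \<in> spectrum (of_nat n *\<^sub>C ((1 / real n) *\<^sub>R (v - w)))"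
      using assms(2) by (subst spectrum_scaleC_iff) auto
    moreover have "of_nat n *\<^sub>C ((1 / real n) *\<^sub>R (v - w)) = v - w"
      using assms(2) by (simp add: scaleC_scaleR scaleR_conv_of_real scaleC_one)
    moreover have "blowup n a f v - blowup n a f w =
        of_nat n * (f (a + (1 / real n) *\<^sub>R v) - f (a + (1 / real n) *\<^sub>R w))"
      by (simp add: blowup_def algebra_simps)
    ultimately show ?thesis
      by (simp only:)
  qed
  then show ?thesis
    by (auto simp: spectral_maps_def blowup_def)
qed

lemma continuous_on_blowup: "continuous_on S (blowup n a)"
proof (rule continuous_on_coordinatewise_then_product)
  fix v
  have "continuous_on UNIV (\<lambda>f. blowup n a f v)"
    unfolding blowup_def by (intro continuous_intros continuous_on_product_coordinates)
  then show "continuous_on S (\<lambda>f. blowup n a f v)"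
    by (rule continuous_on_subset) auto
qed

section \<open>Extremal and minimal blow-up invariant sets\<close>

definition blowup_invariant :: "('a::complex_unital_banach_algebra \<Rightarrow> complex) set \<Rightarrow> bool"
  where "blowup_invariant C \<longleftrightarrow> C \<noteq> {} \<and> closed C \<and> C \<subseteq> spectral_maps \<and>
    (\<forall>f\<in>C. \<forall>n>0. \<forall>a. blowup n a f \<in> C)"

text \<open>\<open>I\<close> and \<open>p\<close> are chosen before \<open>f\<close>: the pieces of
  scale \<open>1/n\<close> form a fixed tiling over which \<open>X\<close> averages. Pairs index the
  tiles of a parallelogram; subdivisions of a segment use second index 0.\<close>

definition tile_functional :: "(('a::complex_unital_banach_algebra \<Rightarrow> complex) \<Rightarrow> real) \<Rightarrow> bool"
  where "tile_functional X \<longleftrightarrow> continuous_on spectral_maps X \<and>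
    (\<exists>L\<ge>0. \<forall>f\<in>spectral_maps. \<forall>a. \<bar>X (blowup 1 a f) - X f\<bar> \<le> L * norm a) \<and>
    (\<forall>n>0. \<exists>(I :: (nat \<times> nat) set) p. finite I \<and> I \<noteq> {} \<and>
      (\<forall>f\<in>spectral_maps. (\<Sum>i\<in>I. X (blowup n (p i) f)) = real (card I) * X f))"

text \<open>Let \<open>X\<close> attain its maximum \<open>m\<close> at \<open>f0\<close>.
  Translating \<open>f0\<close> by \<open>a / N\<close> costs at most \<open>L norm a / N\<close>,
  so the tiles of the translate average nearly \<open>m\<close>. For finitely many \<open>a\<close>
  and large \<open>N\<close>, one tile of \<open>f0\<close> is thus nearly maximal under all these
  translations, and compactness yields a map with the exact value \<open>m\<close> under every
  translation.\<close>

lemma tile_functional_extremal: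
  fixes C :: "('a::complex_unital_banach_algebra \<Rightarrow> complex) set"
  assumes X: "tile_functional X" and C: "blowup_invariant C"
  obtains m where "\<And>f. f \<in> C \<Longrightarrow> X f \<le> m" "blowup_invariant {f \<in> C. \<forall>a. X (blowup 1 a f) = m}"
proof -
  have CK: "C \<subseteq> spectral_maps" and "closed C" "C \<noteq> {}"
    and inv: "\<And>f n a. f \<in> C \<Longrightarrow> n > 0 \<Longrightarrow> blowup n a f \<in> C"
    using C by (auto simp: blowup_invariant_def)
  have "compact C"
    using closed_Int_compact[OF \<open>closed C\<close> compact_spectral_maps] CK by (simp add: inf.absorb1)
  have contX: "continuous_on C X"
    using X CK by (auto simp: tile_functional_def intro: continuous_on_subset)
  have contT: "continuous_on C (\<lambda>f. X (blowup 1 a f))" for a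
    by (rule continuous_on_compose2[OF contX continuous_on_blowup]) (auto intro: inv)
  obtain L where L: "L \<ge> 0" "\<And>f a. f \<in> spectral_maps \<Longrightarrow> \<bar>X (blowup 1 a f) - X f\<bar> \<le> L * norm a"
    using X by (auto simp: tile_functional_def)
  obtain f0 where f0: "f0 \<in> C" "\<And>f. f \<in> C \<Longrightarrow> X f \<le> X f0"
    using continuous_attains_sup[OF \<open>compact C\<close> \<open>C \<noteq> {}\<close> contX] by blast
  define m where "m = X f0"
  have le: "X f \<le> m" if "f \<in> C" for f
    using f0 that by (simp add: m_def)

  \<comment> \<open>These sets form the family for the finite intersection property, with tolerance
    \<open>e\<close> for the translation by \<open>a\<close>.\<close>
  define D where "D = (\<lambda>(a, e). C \<inter> (\<lambda>f. X (blowup 1 a f)) -` {m - e..})"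
  have "C \<inter> (\<Inter>i \<in> UNIV \<times> {0<..}. D i) \<noteq> {}"
  proof (rule compact_imp_fip_image[OF \<open>compact C\<close>])
    show "closed (D i)" for i
      unfolding D_def split_beta
      by (intro continuous_closed_preimage contT \<open>closed C\<close> closed_atLeast)
    fix J :: "('a \<times> real) set"
    assume J: "finite J" "J \<subseteq> UNIV \<times> {0<..}"
    \<comment> \<open>The inserted 1 covers the empty \<open>J\<close>.\<close>
    define e where "e = Min (insert 1 (snd ` J))"
    have "e > 0"
      using J by (auto simp: e_def)
    have e_le: "e \<le> snd i" if "i \<in> J" for i
      using J that by (auto simp: e_def)
    define S where "S = (\<Sum>i\<in>J. L * norm (fst i))"
    have "S \<ge> 0"
      unfolding S_def using L by (intro sum_nonneg) auto
    obtain N where N: "real N * e > S"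
      using reals_Archimedean3[OF \<open>e > 0\<close>] by blast
    then have "N > 0"
      using \<open>S \<ge> 0\<close> by (cases "N = 0") auto
    then obtain I :: "(nat \<times> nat) set" and p where I: "finite I" "I \<noteq> {}"
      "\<And>f. f \<in> spectral_maps \<Longrightarrow> (\<Sum>i\<in>I. X (blowup N (p i) f)) = real (card I) * X f"
      using X unfolding tile_functional_def by meson
    \<comment> \<open>This is the shortfall from \<open>m\<close> of tile \<open>j\<close> of
      \<open>f0\<close>, translated by the point in \<open>i\<close>.\<close>
    define d where "d i j = m - X (blowup 1 (fst i) (blowup N (p j) f0))" for i :: "'a \<times> real" and j
    have d_nonneg: "d i j \<ge> 0" for i j
      unfolding d_def using le[OF inv[OF inv[OF f0(1) \<open>N > 0\<close>]]] by simp
    have col: "(\<Sum>j\<in>I. d i j) \<le> real (card I) * (L * norm (fst i) / N)" for i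
    proof -
      define b where "b = (1 / real N) *\<^sub>R fst i"
      have comm: "blowup 1 (fst i) (blowup N (p j) f0) = blowup N (p j) (blowup 1 b f0)" for j
        by (simp add: blowup_blowup b_def add.commute)
      have "f0 \<in> spectral_maps" "blowup 1 b f0 \<in> spectral_maps"
        using f0(1) CK by (auto intro: blowup_spectral_maps)
      then have "\<bar>X (blowup 1 b f0) - m\<bar> \<le> L * norm b"
        and *: "(\<Sum>j\<in>I. X (blowup N (p j) (blowup 1 b f0))) = real (card I) * X (blowup 1 b f0)"
        using L(2) I(3) by (auto simp: m_def)
      then have "m - X (blowup 1 b f0) \<le> L * norm (fst i) / N"
        by (simp add: b_def)
      moreover have "(\<Sum>j\<in>I. d i j) = real (card I) * (m - X (blowup 1 b f0))"
        by (simp add: d_def sum_subtractf comm * right_diff_distrib del: One_nat_def)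
      ultimately show ?thesis
        by (simp only:) (intro mult_left_mono, auto)
    qed
    have "(\<Sum>j\<in>I. \<Sum>i\<in>J. d i j) = (\<Sum>i\<in>J. \<Sum>j\<in>I. d i j)"
      by (rule sum.swap)
    also have "\<dots> \<le> (\<Sum>i\<in>J. real (card I) * (L * norm (fst i) / N))"
      by (intro sum_mono col)
    also have "\<dots> = real (card I) * (S / N)"
      by (simp add: S_def sum_distrib_left sum_divide_distrib)
    also have "\<dots> \<le> real (card I) * e"
      using N \<open>N > 0\<close> by (intro mult_left_mono) (auto simp: field_simps)
    finally have "\<not> (\<Sum>j\<in>I. e) < (\<Sum>j\<in>I. \<Sum>i\<in>J. d i j)"
      by simp
    \<comment> \<open>Pigeonhole: the total shortfall is at most \<open>card I\<close> times
      \<open>e\<close>.\<close>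
    then obtain j where j: "j \<in> I" "(\<Sum>i\<in>J. d i j) \<le> e"
      using sum_strict_mono[OF I(1,2), of "\<lambda>_. e" "\<lambda>j. \<Sum>i\<in>J. d i j"] by (meson not_le)
    have "blowup N (p j) f0 \<in> D i" if "i \<in> J" for i
    proof -
      have "d i j \<le> (\<Sum>i\<in>J. d i j)"
        using J that d_nonneg by (intro member_le_sum) auto
      then have "d i j \<le> snd i"
        using j e_le[OF that] by linarith
      then show ?thesis
        using inv[OF f0(1) \<open>N > 0\<close>] by (auto simp: D_def d_def split_beta)
    qed
    then show "C \<inter> (\<Inter>i\<in>J. D i) \<noteq> {}"
      using inv[OF f0(1) \<open>N > 0\<close>] by blast
  qed
  then obtain f where fD: "f \<in> C" "f \<in> (\<Inter>i \<in> UNIV \<times> {0<..}. D i)"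
    by blast
  have f: "X (blowup 1 a f) \<ge> m - e" if "e > 0" for a e
  proof -
    have "f \<in> D (a, e)"
      using fD(2) that by blast
    then show ?thesis
      by (simp add: D_def)
  qed
  let ?C' = "{f \<in> C. \<forall>a. X (blowup 1 a f) = m}"
  have "X (blowup 1 a f) \<ge> m" for a
    by (rule field_le_epsilon) (use f[of _ a] in \<open>simp add: algebra_simps\<close>)
  then have "f \<in> ?C'"
    using fD(1) le[OF inv[of f 1]] by (auto intro: antisym)
  moreover have "closed ?C'"
  proof -
    have "closed (C \<inter> (\<Inter>a. C \<inter> (\<lambda>f. X (blowup 1 a f)) -` {m}))"
      by (intro closed_Int closed_INT ballI continuous_closed_preimage contT \<open>closed C\<close> closed_singleton)
    moreover have "?C' = C \<inter> (\<Inter>a. C \<inter> (\<lambda>f. X (blowup 1 a f)) -` {m})"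
      by auto
    ultimately show ?thesis
      by (simp only:)
  qed
  moreover have "blowup n a g \<in> ?C'" if g: "g \<in> ?C'" and "n > 0" for n a g
  proof -
    have "X (blowup 1 b (blowup n a g)) = m" for b
    proof -
      obtain I :: "(nat \<times> nat) set" and p where I: "finite I" "I \<noteq> {}"
        "\<And>f. f \<in> spectral_maps \<Longrightarrow> (\<Sum>i\<in>I. X (blowup n (p i) f)) = real (card I) * X f"
        using X \<open>n > 0\<close> unfolding tile_functional_def by meson
      obtain i where "i \<in> I"
        using I by auto
      \<comment> \<open>With this \<open>c\<close>, tile \<open>i\<close> of the translate of
        \<open>g\<close> is the blow-up in question. The translate has value \<open>m\<close>, an
        average of tile values at most \<open>m\<close>, so each tile has value
        \<open>m\<close>.\<close>
      define c where "c = a + (1 / real n) *\<^sub>R b - p i"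
      have "blowup 1 c g \<in> C"
        using g by (auto intro: inv)
      then have le': "X (blowup n (p j) (blowup 1 c g)) \<le> m" for j
        using le inv \<open>n > 0\<close> by blast
      have "X (blowup 1 c g) = m"
        using g by auto
      then have "(\<Sum>j\<in>I. m - X (blowup n (p j) (blowup 1 c g))) = 0"
        using I(3)[of "blowup 1 c g"] \<open>blowup 1 c g \<in> C\<close> CK by (auto simp: sum_subtractf)
      then have "m - X (blowup n (p i) (blowup 1 c g)) = 0"
        using le' I(1) \<open>i \<in> I\<close> by (subst (asm) sum_nonneg_eq_0_iff) auto
      moreover have "blowup n (p i) (blowup 1 c g) = blowup 1 b (blowup n a g)"
        by (simp add: blowup_blowup c_def)
      ultimately show ?thesis
        by simp
    qed
    then show ?thesis
      using g \<open>n > 0\<close> by (auto intro: inv)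
  qed
  ultimately have "blowup_invariant ?C'"
    using CK unfolding blowup_invariant_def by blast
  with le that show ?thesis
    by blast
qed

lemma minimal_blowup_invariant:
  assumes "blowup_invariant C"
  obtains M where "blowup_invariant M" "M \<subseteq> C" "\<And>M'. blowup_invariant M' \<Longrightarrow> M' \<subseteq> M \<Longrightarrow> M' = M"
proof -
  \<comment> \<open>Complements turn minimal sets into maximal ones for Zorn's lemma, and being open
    they suit the covering argument.\<close>
  define A where "A = uminus ` {M. blowup_invariant M \<and> M \<subseteq> C}"
  have "\<exists>U\<in>A. \<forall>X\<in>A. U \<subseteq> X \<longrightarrow> X = U"
  proof (rule subset_Zorn_nonempty)
    show "A \<noteq> {}"
      using assms by (auto simp: A_def)
    fix B
    assume "B \<noteq> {}" and B: "subset.chain A B"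
    then have BA: "B \<subseteq> A"
      by (simp add: subset.chain_def)
    \<comment> \<open>Otherwise the complements cover \<open>spectral_maps\<close>. A finite
      subcover is a chain and contains its union, so a single complement covers everything, although
      its set is a nonempty set of spectral maps.\<close>
    have "\<Inter> (uminus ` B) \<noteq> {}"
    proof
      assume *: "\<Inter> (uminus ` B) = {}"
      have "open b" if "b \<in> B" for b
        using that BA by (auto simp: A_def blowup_invariant_def)
      moreover have "spectral_maps \<subseteq> \<Union>B"
        using * by blast
      ultimately obtain B' where B': "B' \<subseteq> B" "finite B'" "spectral_maps \<subseteq> \<Union>B'"
        using compactE[OF compact_spectral_maps] by metis
      have "B' \<noteq> {}"
        using B'(3) assms by (auto simp: blowup_invariant_def)
      have "B' \<subseteq> A"
        using BA B'(1) by (rule order_trans[rotated])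
      moreover have "\<forall>X\<in>B'. \<forall>Y\<in>B'. X \<subseteq> Y \<or> Y \<subseteq> X"
        using B B'(1) unfolding subset_chain_def by (meson subsetD)
      ultimately have "subset.chain A B'"
        unfolding subset_chain_def by (rule conjI)
      then have "\<Union>B' \<in> B'"
        by (rule Union_in_chain[OF \<open>finite B'\<close> \<open>B' \<noteq> {}\<close>])
      then obtain M where "blowup_invariant M" "\<Union>B' = - M"
        using B' BA by (auto simp: A_def)
      then show False
        using B'(3) by (auto simp: blowup_invariant_def)
    qed
    moreover have mem: "blowup_invariant M" "M \<subseteq> C" if "M \<in> uminus ` B" for M
      using that BA by (auto simp: A_def)
    have "closed (\<Inter> (uminus ` B))"
      using mem(1) by (intro closed_Inter ballI) (simp add: blowup_invariant_def)
    moreover obtain M where "M \<in> uminus ` B"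
      using \<open>B \<noteq> {}\<close> by blast
    then have "\<Inter> (uminus ` B) \<subseteq> M" "M \<subseteq> spectral_maps" "M \<subseteq> C"
      using mem by (auto simp: blowup_invariant_def)
    then have "\<Inter> (uminus ` B) \<subseteq> spectral_maps" "\<Inter> (uminus ` B) \<subseteq> C"
      by (meson order_trans)+
    moreover have "blowup n a f \<in> \<Inter> (uminus ` B)" if "f \<in> \<Inter> (uminus ` B)" "n > 0" for n a f
    proof (rule InterI)
      fix M
      assume "M \<in> uminus ` B"
      then have "blowup_invariant M" "f \<in> M"
        using mem(1) that(1) by blast+
      then show "blowup n a f \<in> M"
        using \<open>n > 0\<close> by (simp add: blowup_invariant_def)
    qed
    ultimately have "blowup_invariant (\<Inter> (uminus ` B)) \<and> \<Inter> (uminus ` B) \<subseteq> C"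
      unfolding blowup_invariant_def by (intro conjI ballI allI impI)
    moreover have "\<Union>B = - \<Inter> (uminus ` B)"
      by auto
    ultimately show "\<Union>B \<in> A"
      unfolding A_def by blast
  qed
  then obtain U where U: "U \<in> A" "\<And>X. X \<in> A \<Longrightarrow> U \<subseteq> X \<Longrightarrow> X = U"
    by blast
  then obtain M where M: "blowup_invariant M" "M \<subseteq> C" "U = - M"
    unfolding A_def by blast
  have "M' = M" if M': "blowup_invariant M'" "M' \<subseteq> M" for M'
  proof -
    have "- M' \<in> A"
      using M' M(2) unfolding A_def by blast
    then have "- M' = U"
      using M'(2) M(3) by (intro U(2)) auto
    then show ?thesis
      using M(3) by simp
  qed
  with M that show ?thesis
    by blast
qed

text \<open>The increments of \<open>f\<close> between consecutive points \<open>j v / n\<close>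
  telescope to \<open>f v\<close>, and each is \<open>1/n\<close> times a blow-up evaluated at
  \<open>v\<close>.\<close>

lemma tile_functional_evaluation:
  "tile_functional (\<lambda>f :: 'a::complex_unital_banach_algebra \<Rightarrow> complex. Re (c * f v))"
  unfolding tile_functional_def
proof (intro conjI allI impI)
  have "continuous_on UNIV (\<lambda>f :: 'a \<Rightarrow> complex. Re (c * f v))"
    by (intro continuous_intros continuous_on_product_coordinates)
  then show "continuous_on spectral_maps (\<lambda>f :: 'a \<Rightarrow> complex. Re (c * f v))"
    by (rule continuous_on_subset) auto
  have "\<bar>Re (c * blowup 1 a f v) - Re (c * f v)\<bar> \<le> 2 * cmod c * norm a"
    if f: "f \<in> spectral_maps" for f and a :: 'a
  proof -
    have "cmod (f (a + v) - f v) \<le> norm a" "cmod (f a) \<le> norm a"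
      using spectral_mapsD(4)[OF f, of "a + v" v] spectral_mapsD(5)[OF f] by auto
    then have "cmod (f (a + v) - f v - f a) \<le> 2 * norm a"
      using norm_triangle_ineq4[of "f (a + v) - f v" "f a"] by linarith
    then have "cmod c * cmod (f (a + v) - f v - f a) \<le> cmod c * (2 * norm a)"
      by (intro mult_left_mono) auto
    moreover have "Re (c * blowup 1 a f v) - Re (c * f v) = Re (c * (f (a + v) - f v - f a))"
      by (simp add: blowup_def algebra_simps)
    ultimately show ?thesis
      using abs_Re_le_cmod[of "c * (f (a + v) - f v - f a)"] by (simp add: norm_mult)
  qed
  then show "\<exists>L\<ge>0. \<forall>f\<in>spectral_maps. \<forall>a :: 'a. \<bar>Re (c * blowup 1 a f v) - Re (c * f v)\<bar> \<le> L * norm a"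
    by (intro exI[of _ "2 * cmod c"]) auto
  fix n :: nat
  assume "n > 0"
  define p where "p = (\<lambda>(j :: nat, k :: nat). (real j / real n) *\<^sub>R v)"
  have "(\<Sum>i\<in>(\<lambda>j. (j, 0)) ` {..<n}. Re (c * blowup n (p i) f v)) = real (card ((\<lambda>j. (j, 0 :: nat)) ` {..<n})) * Re (c * f v)"
    if f: "f \<in> spectral_maps" for f
  proof -
    have "(\<Sum>i\<in>(\<lambda>j. (j, 0)) ` {..<n}. blowup n (p i) f v) = (\<Sum>j<n. blowup n (p (j, 0)) f v)"
      by (subst sum.reindex) (auto simp: inj_on_def)
    also have "\<dots> = (\<Sum>j<n. of_nat n * (f ((real (Suc j) / n) *\<^sub>R v) - f ((real j / n) *\<^sub>R v)))"
      by (simp add: blowup_def p_def add_divide_distrib scaleR_left_distrib add.commute)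
    also have "\<dots> = of_nat n * (\<Sum>j<n. f ((real (Suc j) / n) *\<^sub>R v) - f ((real j / n) *\<^sub>R v))"
      by (simp add: sum_distrib_left)
    also have "\<dots> = of_nat n * f v"
      by (subst sum_lessThan_telescope) (use \<open>n > 0\<close> spectral_mapsD(1)[OF f] in simp)
    finally have "Re (c * (\<Sum>i\<in>(\<lambda>j. (j, 0)) ` {..<n}. blowup n (p i) f v)) = real n * Re (c * f v)"
      by (simp add: mult.left_commute[of c] flip: of_nat_mult)
    then show ?thesis
      by (simp add: sum_distrib_left card_image inj_on_def)
  qed
  then show "\<exists>(I :: (nat \<times> nat) set) p. finite I \<and> I \<noteq> {} \<and>
      (\<forall>f\<in>spectral_maps. (\<Sum>i\<in>I. Re (c * blowup n (p i) f v)) = real (card I) * Re (c * f v))"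
    using \<open>n > 0\<close> by (intro exI[of _ "(\<lambda>j. (j, 0)) ` {..<n}"] exI[of _ p]) auto
qed

text \<open>In a minimal set the extremal subset for \<open>Re (c f(v))\<close> is the whole set, so
  these values do not change under translations.\<close>

lemma additive_in_blowup_invariant:
  fixes C :: "('a::complex_unital_banach_algebra \<Rightarrow> complex) set"
  assumes "blowup_invariant C"
  obtains h where "h \<in> C" "\<And>x y. h (x + y) = h x + h y"
proof -
  obtain M where M: "blowup_invariant M" "M \<subseteq> C"
    "\<And>M'. blowup_invariant M' \<Longrightarrow> M' \<subseteq> M \<Longrightarrow> M' = M"
    using minimal_blowup_invariant[OF assms] by blast
  obtain h where h: "h \<in> M"
    using M(1) by (auto simp: blowup_invariant_def)
  then have h0: "h 0 = 0"
    using M(1) spectral_mapsD(1) by (auto simp: blowup_invariant_def)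
  have "Re (c * blowup 1 a h v) = Re (c * blowup 1 0 h v)" for c a v
  proof -
    obtain m where "blowup_invariant {f \<in> M. \<forall>a. Re (c * blowup 1 a f v) = m}"
      using tile_functional_extremal[OF tile_functional_evaluation[of c v] M(1)] by blast
    then have "{f \<in> M. \<forall>a. Re (c * blowup 1 a f v) = m} = M"
      by (rule M(3)) auto
    with h have "h \<in> {f \<in> M. \<forall>a. Re (c * blowup 1 a f v) = m}"
      by (simp only:)
    then show ?thesis
      by (simp only: mem_Collect_eq)
  qed
  \<comment> \<open>The coefficients \<open>1\<close> and \<open>- \<i>\<close> extract real and
    imaginary parts.\<close>
  from this[of 1] this[of "- \<i>"] have "blowup 1 a h v = blowup 1 0 h v" for a v
    by (simp add: complex_eq_iff)
  then have "h (a + v) - h a = h v" for a v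
    by (simp add: blowup_def h0)
  then have "h (a + v) = h a + h v" for a v
    by (simp add: diff_eq_eq add.commute)
  with h M(2) that show ?thesis
    by blast
qed

text \<open>A tile functional with a positive maximum would be positive at some additive spectral map.\<close>

lemma tile_functional_nonpos:
  fixes X :: "('a::complex_unital_banach_algebra \<Rightarrow> complex) \<Rightarrow> real"
  assumes X: "tile_functional X"
    and zero: "\<And>h. h \<in> spectral_maps \<Longrightarrow> complex_linear h \<Longrightarrow> X h = 0"
    and f: "f \<in> spectral_maps"
  shows "X f \<le> 0"
proof -
  have "blowup_invariant (spectral_maps :: ('a \<Rightarrow> complex) set)"
    using f closed_spectral_maps by (auto simp: blowup_invariant_def intro: blowup_spectral_maps)
  from tile_functional_extremal[OF X this]
  obtain m where m: "X f \<le> m" "blowup_invariant {f \<in> spectral_maps. \<forall>a. X (blowup 1 a f) = m}"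
    using f by blast
  obtain h where h: "h \<in> {f \<in> spectral_maps. \<forall>a. X (blowup 1 a f) = m}"
    and add: "\<And>x y. h (x + y) = h x + h y"
    using additive_in_blowup_invariant[OF m(2)] by blast
  then have hK: "h \<in> spectral_maps" and "X (blowup 1 0 h) = m"
    by blast+
  moreover have "complex_linear h"
    using hK add by (rule additive_spectral_map)
  moreover have "blowup 1 0 h = h"
    using spectral_mapsD(1)[OF hK] by (simp add: blowup_def fun_eq_iff)
  ultimately show ?thesis
    using m(1) zero by simp
qed

section \<open>Parallelogram integrals\<close>

text \<open>This is the mean over the segment from \<open>p\<close> to \<open>p + v\<close>; the
  direction factor of a contour integral is supplied in \<open>para_integral\<close>.\<close>

definition seg_integral :: "('a::real_normed_vector \<Rightarrow> complex) \<Rightarrow> 'a \<Rightarrow> 'a \<Rightarrow> complex"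
  where "seg_integral f p v = integral {0..1} (\<lambda>s. f (p + s *\<^sub>R v))"

lemma spectral_maps_continuous:
  assumes "f \<in> spectral_maps"
  shows "continuous_on S f"
proof (rule continuous_on_subset[OF lipschitz_on_continuous_on])
  show "1-lipschitz_on UNIV f"
    using spectral_mapsD(4)[OF assms] by (auto simp: lipschitz_on_def dist_norm)
qed auto

lemma spectral_maps_continuous_segment:
  assumes "f \<in> spectral_maps"
  shows "continuous_on S (\<lambda>s. f (p + s *\<^sub>R v))"
  by (rule continuous_on_compose2[OF spectral_maps_continuous[OF assms, of UNIV]])
    (auto intro!: continuous_intros)

lemma spectral_maps_integrable_segment:
  assumes "f \<in> spectral_maps"
  shows "(\<lambda>s. f (p + s *\<^sub>R v)) integrable_on {a..b}"
  by (intro integrable_continuous_real spectral_maps_continuous_segment assms)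

lemma seg_integral_translate:
  assumes "f \<in> spectral_maps"
  shows "cmod (seg_integral f p v - seg_integral f q v) \<le> norm (p - q)"
proof -
  have "seg_integral f p v - seg_integral f q v =
      integral {0..1} (\<lambda>s. f (p + s *\<^sub>R v) - f (q + s *\<^sub>R v))"
    unfolding seg_integral_def
    by (intro integral_diff[symmetric] spectral_maps_integrable_segment assms)
  also have "cmod \<dots> \<le> norm (p - q) * (1 - 0)"
  proof (rule integral_bound)
    show "continuous_on {0..1} (\<lambda>s. f (p + s *\<^sub>R v) - f (q + s *\<^sub>R v))"
      by (intro continuous_on_diff spectral_maps_continuous_segment assms)
    show "cmod (f (p + t *\<^sub>R v) - f (q + t *\<^sub>R v)) \<le> norm (p - q)" for t
      using spectral_mapsD(4)[OF assms, of "p + t *\<^sub>R v" "q + t *\<^sub>R v"] by simp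
  qed simp
  finally show ?thesis
    by simp
qed

lemma seg_integral_approx:
  assumes "f \<in> spectral_maps"
  shows "cmod (seg_integral f p v - f p) \<le> norm v"
proof -
  have "seg_integral f p v - f p = integral {0..1} (\<lambda>s. f (p + s *\<^sub>R v) - f p)"
    unfolding seg_integral_def
    by (subst integral_diff) (auto intro: spectral_maps_integrable_segment assms)
  also have "cmod \<dots> \<le> norm v * (1 - 0)"
  proof (rule integral_bound)
    show "continuous_on {0..1} (\<lambda>s. f (p + s *\<^sub>R v) - f p)"
      by (intro continuous_on_diff spectral_maps_continuous_segment assms continuous_on_const)
    fix t :: real
    assume "t \<in> {0..1}"
    then have "\<bar>t\<bar> * norm v \<le> 1 * norm v"
      by (intro mult_right_mono) auto
    then show "cmod (f (p + t *\<^sub>R v) - f p) \<le> norm v"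
      using spectral_mapsD(4)[OF assms, of "p + t *\<^sub>R v" p] by simp
  qed simp
  finally show ?thesis
    by simp
qed

lemma seg_integral_subdivide:
  assumes f: "f \<in> spectral_maps" and "n > 0"
  shows "of_nat n * seg_integral f p v =
    (\<Sum>j<n. seg_integral f (p + (real j / real n) *\<^sub>R v) ((1 / real n) *\<^sub>R v))"
proof -
  define g where "g s = f (p + s *\<^sub>R v)" for s
  have int: "g integrable_on {a..b}" for a b
    unfolding g_def by (rule spectral_maps_integrable_segment[OF f])
  have piece: "of_nat n * integral {j / n..(j + 1) / n} g =
      seg_integral f (p + (j / real n) *\<^sub>R v) ((1 / real n) *\<^sub>R v)" for j :: real
  proof -
    have "((\<lambda>x. g ((1 / n) *\<^sub>R x + j / n)) has_integral integral {j / n..(j + 1) / n} g /\<^sub>R (1 / n) ^ DIM(real))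
        (cbox ((j / n - j / n) /\<^sub>R (1 / n)) (((j + 1) / n - j / n) /\<^sub>R (1 / n)))"
      using int \<open>n > 0\<close> by (intro has_integral_affinity') (auto simp: integrable_integral)
    moreover have "cbox ((j / n - j / n) /\<^sub>R (1 / n)) (((j + 1) / n - j / n) /\<^sub>R (1 / n)) = {0..1}"
      using \<open>n > 0\<close> by (simp add: field_simps)
    moreover have "g ((1 / n) *\<^sub>R x + j / n) = f (p + (j / n) *\<^sub>R v + x *\<^sub>R ((1 / n) *\<^sub>R v))" for x
      by (simp add: g_def scaleR_left_distrib add_ac)
    ultimately show ?thesis
      unfolding seg_integral_def
      by (simp add: integral_unique scaleR_conv_of_real)
  qed
  \<comment> \<open>The mesh \<open>1/n\<close> stays fixed while the number \<open>m\<close> of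
    pieces grows.\<close>
  have "of_nat n * integral {0..real m / n} g =
      (\<Sum>j<m. seg_integral f (p + (real j / real n) *\<^sub>R v) ((1 / real n) *\<^sub>R v))" for m
  proof (induction m)
    case (Suc m)
    have *: "integral {0..real m / n} g + integral {real m / n..(real m + 1) / n} g =
        integral {0..(real m + 1) / n} g"
      by (rule Henstock_Kurzweil_Integration.integral_combine) (auto intro: int simp: divide_right_mono)
    have "real (Suc m) = real m + 1"
      by simp
    then show ?case
      by (simp only: *[symmetric] distrib_left Suc.IH piece sum.lessThan_Suc)
  qed simp
  from this[of n] show ?thesis
    using \<open>n > 0\<close> by (simp add: seg_integral_def g_def[abs_def])
qed

lemma seg_integral_blowup:
  assumes "f \<in> spectral_maps"
  shows "seg_integral (blowup n q f) p v =
    of_nat n * (seg_integral f (q + (1 / real n) *\<^sub>R p) ((1 / real n) *\<^sub>R v) - f q)"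
proof -
  have "blowup n q f (p + s *\<^sub>R v) =
      of_nat n * (f ((q + (1 / real n) *\<^sub>R p) + s *\<^sub>R ((1 / real n) *\<^sub>R v)) - f q)" for s
    by (simp add: blowup_def scaleR_right_distrib add.assoc)
  moreover have "integral {0..1} (\<lambda>s. f ((q + (1 / real n) *\<^sub>R p) + s *\<^sub>R ((1 / real n) *\<^sub>R v)) - f q) =
      seg_integral f (q + (1 / real n) *\<^sub>R p) ((1 / real n) *\<^sub>R v) - f q"
    unfolding seg_integral_def
    using integral_diff[OF spectral_maps_integrable_segment[OF assms,
          of "q + (1 / real n) *\<^sub>R p" "(1 / real n) *\<^sub>R v" 0 1]
        integrable_continuous_real[OF continuous_on_const[of _ "f q"]]]
    by simp
  ultimately show ?thesis
    by (simp add: seg_integral_def)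
qed

text \<open>Riemann sums involve finitely many values of \<open>f\<close>, so they are continuous
  for pointwise convergence; the common Lipschitz constant makes them converge uniformly on the
  spectral maps.\<close>

lemma continuous_on_seg_integral:
  "continuous_on spectral_maps (\<lambda>f. seg_integral f p (v :: 'a::complex_unital_banach_algebra))"
proof (rule uniform_limit_theorem)
  let ?r = "\<lambda>n (f :: 'a \<Rightarrow> complex). (\<Sum>j<Suc n. f (p + (real j / real (Suc n)) *\<^sub>R v)) / of_nat (Suc n)"
  have "continuous_on UNIV (?r n)" for n
    by (intro continuous_intros continuous_on_product_coordinates) (simp del: of_nat_Suc)
  then have "continuous_on spectral_maps (?r n)" for n
    by (rule continuous_on_subset) auto
  then show "\<forall>\<^sub>F n in sequentially. continuous_on spectral_maps (?r n)"
    by simp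
  have bound: "dist (?r n f) (seg_integral f p v) \<le> norm v / real (Suc n)"
    if f: "f \<in> spectral_maps" for n f
  proof -
    let ?p = "\<lambda>j. p + (real j / real (Suc n)) *\<^sub>R v" and ?v = "(1 / real (Suc n)) *\<^sub>R v"
    have "seg_integral f p v = (\<Sum>j<Suc n. seg_integral f (?p j) ?v) / of_nat (Suc n)"
      by (subst seg_integral_subdivide[OF f, symmetric]) (simp_all del: of_nat_Suc)
    then have "seg_integral f p v - ?r n f = (\<Sum>j<Suc n. seg_integral f (?p j) ?v - f (?p j)) / of_nat (Suc n)"
      by (simp only: sum_subtractf diff_divide_distrib)
    moreover have "cmod (\<Sum>j<Suc n. seg_integral f (?p j) ?v - f (?p j)) \<le> (\<Sum>j<Suc n. norm ?v)"
      by (intro sum_norm_le seg_integral_approx f)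
    moreover have "(\<Sum>j<Suc n. norm ?v) = norm v"
      by (simp del: of_nat_Suc)
    ultimately show ?thesis
      by (simp add: dist_norm norm_minus_commute norm_divide divide_right_mono del: of_nat_Suc sum.lessThan_Suc)
  qed
  show "uniform_limit spectral_maps ?r (\<lambda>f. seg_integral f p v) sequentially"
  proof (rule uniform_limitI)
    fix e :: real
    assume "e > 0"
    have "(\<lambda>n. norm v / real (Suc n)) \<longlonglongrightarrow> 0"
      using LIMSEQ_Suc[OF lim_const_over_n[of "norm v"]] by simp
    then have "\<forall>\<^sub>F n in sequentially. norm v / real (Suc n) < e"
      using \<open>e > 0\<close> by (rule order_tendstoD)
    then show "\<forall>\<^sub>F n in sequentially. \<forall>f\<in>spectral_maps. dist (?r n f) (seg_integral f p v) < e"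
      by eventually_elim (use bound in \<open>blast intro: le_less_trans\<close>)
  qed
qed simp

text \<open>With \<open>u = c y\<close> and \<open>w = d y\<close>, this is the contour integral of \<open>\<lambda> \<mapsto> f (\<lambda> y)\<close> around the
  parallelogram with vertices \<open>0, c, c + d, d\<close>.\<close>

definition para_integral :: "complex \<Rightarrow> complex \<Rightarrow> 'a \<Rightarrow> 'a \<Rightarrow> ('a::real_normed_vector \<Rightarrow> complex) \<Rightarrow> complex"
  where "para_integral c d u w f =
    c * (seg_integral f 0 u - seg_integral f w u) + d * (seg_integral f u w - seg_integral f 0 w)"

text \<open>The constants \<open>f q\<close> subtracted by the blow-up cancel between opposite
  sides.\<close>

lemma para_integral_blowup:
  assumes "f \<in> spectral_maps"
  shows "para_integral c d u w (blowup n q f) = of_nat n *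
    (c * (seg_integral f q ((1 / real n) *\<^sub>R u) - seg_integral f (q + (1 / real n) *\<^sub>R w) ((1 / real n) *\<^sub>R u)) +
     d * (seg_integral f (q + (1 / real n) *\<^sub>R u) ((1 / real n) *\<^sub>R w) - seg_integral f q ((1 / real n) *\<^sub>R w)))"
  by (simp add: para_integral_def seg_integral_blowup[OF assms] algebra_simps)

text \<open>Edges shared by neighbouring tiles cancel, as in Goursat's proof. One factor
  \<open>n\<close> comes from the blow-up, the other from reassembling each outer side.\<close>

lemma para_integral_tile:
  assumes f: "f \<in> spectral_maps" and "n > 0"
  shows "(\<Sum>(j, k)\<in>{..<n} \<times> {..<n}.
      para_integral c d u w (blowup n ((real j / real n) *\<^sub>R u + (real k / real n) *\<^sub>R w) f)) =
    of_nat (n * n) * para_integral c d u w f"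
proof -
  let ?q = "\<lambda>j k :: nat. (real j / real n) *\<^sub>R u + (real k / real n) *\<^sub>R w"
  let ?u = "(1 / real n) *\<^sub>R u" and ?w = "(1 / real n) *\<^sub>R w"
  have q1: "?q j k + ?u = ?q (Suc j) k" and q2: "?q j k + ?w = ?q j (Suc k)" for j k
    by (simp_all add: add_divide_distrib scaleR_left_distrib add_ac)
  have 1: "(\<Sum>j<n. \<Sum>k<n. seg_integral f (?q j k) ?u - seg_integral f (?q j (Suc k)) ?u) =
      of_nat n * (seg_integral f 0 u - seg_integral f w u)"
  proof -
    have "(\<Sum>j<n. \<Sum>k<n. seg_integral f (?q j k) ?u - seg_integral f (?q j (Suc k)) ?u) =
        (\<Sum>j<n. seg_integral f (?q j 0) ?u - seg_integral f (?q j n) ?u)"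
      by (intro sum.cong refl) (rule sum_lessThan_telescope')
    also have "\<dots> = (\<Sum>j<n. seg_integral f (0 + (real j / real n) *\<^sub>R u) ?u)
        - (\<Sum>j<n. seg_integral f (w + (real j / real n) *\<^sub>R u) ?u)"
      using \<open>n > 0\<close> by (simp add: sum_subtractf add.commute)
    also have "\<dots> = of_nat n * (seg_integral f 0 u - seg_integral f w u)"
      by (simp only: seg_integral_subdivide[OF f \<open>n > 0\<close>, symmetric] right_diff_distrib)
    finally show ?thesis .
  qed
  have 2: "(\<Sum>j<n. \<Sum>k<n. seg_integral f (?q (Suc j) k) ?w - seg_integral f (?q j k) ?w) =
      of_nat n * (seg_integral f u w - seg_integral f 0 w)"
  proof -
    have "(\<Sum>j<n. \<Sum>k<n. seg_integral f (?q (Suc j) k) ?w - seg_integral f (?q j k) ?w) =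
        (\<Sum>k<n. \<Sum>j<n. seg_integral f (?q (Suc j) k) ?w - seg_integral f (?q j k) ?w)"
      by (rule sum.swap)
    also have "\<dots> = (\<Sum>k<n. seg_integral f (?q n k) ?w - seg_integral f (?q 0 k) ?w)"
      by (intro sum.cong refl) (rule sum_lessThan_telescope)
    also have "\<dots> = (\<Sum>k<n. seg_integral f (u + (real k / real n) *\<^sub>R w) ?w)
        - (\<Sum>k<n. seg_integral f (0 + (real k / real n) *\<^sub>R w) ?w)"
      using \<open>n > 0\<close> by (simp add: sum_subtractf)
    also have "\<dots> = of_nat n * (seg_integral f u w - seg_integral f 0 w)"
      by (simp only: seg_integral_subdivide[OF f \<open>n > 0\<close>, symmetric] right_diff_distrib)
    finally show ?thesis .
  qed
  have "(\<Sum>(j, k)\<in>{..<n} \<times> {..<n}. para_integral c d u w (blowup n (?q j k) f)) =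
      (\<Sum>j<n. \<Sum>k<n. para_integral c d u w (blowup n (?q j k) f))"
    by (rule sum.cartesian_product[symmetric])
  also have "\<dots> = of_nat n *
      (c * (\<Sum>j<n. \<Sum>k<n. seg_integral f (?q j k) ?u - seg_integral f (?q j (Suc k)) ?u) +
       d * (\<Sum>j<n. \<Sum>k<n. seg_integral f (?q (Suc j) k) ?w - seg_integral f (?q j k) ?w))"
    unfolding para_integral_blowup[OF f] q1 q2 by (simp only: sum_distrib_left sum.distrib distrib_left)
  also have "\<dots> = of_nat (n * n) * para_integral c d u w f"
    unfolding 1 2 para_integral_def by (simp add: algebra_simps)
  finally show ?thesis .
qed

lemma tile_functional_para_integral:
  fixes u w :: "'a::complex_unital_banach_algebra"
  shows "tile_functional (\<lambda>f. Re (e * para_integral c d u w f))"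
  unfolding tile_functional_def
proof (intro conjI allI impI)
  show "continuous_on spectral_maps (\<lambda>f. Re (e * para_integral c d u w f))"
    unfolding para_integral_def by (intro continuous_intros continuous_on_seg_integral)
  have "\<bar>Re (e * para_integral c d u w (blowup 1 a f)) - Re (e * para_integral c d u w f)\<bar>
      \<le> cmod e * (2 * (cmod c + cmod d)) * norm a"
    if f: "f \<in> spectral_maps" for f a
  proof -
    let ?d = "\<lambda>p v. seg_integral f (a + p) v - seg_integral f p v"
    \<comment> \<open>Translation moves each side mean by at most \<open>norm a\<close>; the
      renormalising constant drops out of differences of opposite sides.\<close>
    have d: "cmod (?d p v - ?d q v) \<le> 2 * norm a" for p q v
      using seg_integral_translate[OF f, of "a + p" v p] seg_integral_translate[OF f, of "a + q" v q]
        norm_triangle_ineq4[of "?d p v" "?d q v"] by simp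
    have "para_integral c d u w (blowup 1 a f) - para_integral c d u w f =
        c * (?d 0 u - ?d w u) + d * (?d u w - ?d 0 w)"
      by (simp add: para_integral_def seg_integral_blowup[OF f] algebra_simps)
    also have "cmod \<dots> \<le> cmod c * cmod (?d 0 u - ?d w u) + cmod d * cmod (?d u w - ?d 0 w)"
      by (rule order_trans[OF norm_triangle_ineq]) (simp add: norm_mult)
    also have "\<dots> \<le> cmod c * (2 * norm a) + cmod d * (2 * norm a)"
      by (intro add_mono mult_left_mono d) auto
    finally have "cmod e * cmod (para_integral c d u w (blowup 1 a f) - para_integral c d u w f)
        \<le> cmod e * (2 * (cmod c + cmod d) * norm a)"
      by (intro mult_left_mono) (simp_all add: algebra_simps)
    then show ?thesis
      using abs_Re_le_cmod[of "e * (para_integral c d u w (blowup 1 a f) - para_integral c d u w f)"]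
      unfolding norm_mult by (simp add: right_diff_distrib mult.assoc)
  qed
  then show "\<exists>L\<ge>0. \<forall>f\<in>spectral_maps. \<forall>a.
      \<bar>Re (e * para_integral c d u w (blowup 1 a f)) - Re (e * para_integral c d u w f)\<bar> \<le> L * norm a"
    by (intro exI[of _ "cmod e * (2 * (cmod c + cmod d))"]) auto
  fix n :: nat
  assume "n > 0"
  define p where "p = (\<lambda>(j :: nat, k :: nat). (real j / real n) *\<^sub>R u + (real k / real n) *\<^sub>R w)"
  have "(\<Sum>i\<in>{..<n} \<times> {..<n}. Re (e * para_integral c d u w (blowup n (p i) f))) =
      real (card ({..<n} \<times> {..<n})) * Re (e * para_integral c d u w f)" if f: "f \<in> spectral_maps" for f
  proof -
    have "(\<Sum>i\<in>{..<n} \<times> {..<n}. Re (e * para_integral c d u w (blowup n (p i) f))) =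
        Re (e * (\<Sum>i\<in>{..<n} \<times> {..<n}. para_integral c d u w (blowup n (p i) f)))"
      by (simp only: sum_distrib_left Re_sum)
    also have "(\<Sum>i\<in>{..<n} \<times> {..<n}. para_integral c d u w (blowup n (p i) f)) =
        of_nat (n * n) * para_integral c d u w f"
      using para_integral_tile[OF f \<open>n > 0\<close>, of c d u w] by (simp add: p_def split_beta)
    also have "Re (e * (of_nat (n * n) * para_integral c d u w f)) =
        Re (of_nat (n * n) * (e * para_integral c d u w f))"
      by (simp only: mult.left_commute)
    finally show ?thesis
      by (simp del: of_nat_mult)
  qed
  then show "\<exists>(I :: (nat \<times> nat) set) p. finite I \<and> I \<noteq> {} \<and> (\<forall>f\<in>spectral_maps.
      (\<Sum>i\<in>I. Re (e * para_integral c d u w (blowup n (p i) f))) =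
      real (card I) * Re (e * para_integral c d u w f))"
    using \<open>n > 0\<close> by (intro exI[of _ "{..<n} \<times> {..<n}"] exI[of _ p]) auto
qed

text \<open>For linear \<open>h\<close> the means over opposite sides differ by the value of
  \<open>h\<close> at the displacement, leaving \<open>d h (c y) - c h (d y) = 0\<close>. For
  spectral maps, nonpositivity with all four factors \<open>e\<close> means vanishing.\<close>

lemma para_integral_eq_0:
  assumes f: "f \<in> spectral_maps"
  shows "para_integral c d (c *\<^sub>C y) (d *\<^sub>C y) f = 0"
proof -
  have "Re (e * para_integral c d (c *\<^sub>C y) (d *\<^sub>C y) f) \<le> 0" for e
  proof (rule tile_functional_nonpos[OF tile_functional_para_integral _ f])
    fix h :: "'a \<Rightarrow> complex"
    assume h: "h \<in> spectral_maps" "complex_linear h"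
    have "seg_integral h p v = h p + seg_integral h 0 v" for p v
    proof -
      have int: "(\<lambda>s. h (s *\<^sub>R v)) integrable_on {0..1}"
        using spectral_maps_integrable_segment[OF h(1), of 0 v] by simp
      show ?thesis
        unfolding seg_integral_def
        using integral_add[OF integrable_continuous_real[OF continuous_on_const[of _ "h p"]] int]
        by (simp add: complex_linearD(1)[OF h(2)] complex_linearD(4)[OF h(2)])
    qed
    from this[of "c *\<^sub>C y"] this[of "d *\<^sub>C y"]
    show "Re (e * para_integral c d (c *\<^sub>C y) (d *\<^sub>C y) h) = 0"
      by (simp add: para_integral_def complex_linearD(2)[OF h(2)])
  qed
  from this[of 1] this[of "-1"] this[of \<i>] this[of "- \<i>"] show ?thesis
    by (simp add: complex_eq_iff)
qed

text \<open>The vanishing parallelogram integrals say that \<open>\<lambda> \<mapsto> c \<integral> f ((\<lambda> + s c) y) ds\<close> is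
  holomorphic with the bounded derivative \<open>f ((\<lambda> + c) y) - f (\<lambda> y)\<close>.\<close>

lemma spectral_map_increment_const:
  assumes f: "f \<in> spectral_maps"
  shows "f ((l + c) *\<^sub>C y) - f (l *\<^sub>C y) = f (c *\<^sub>C y)"
proof -
  define G where "G l = c * seg_integral f (l *\<^sub>C y) (c *\<^sub>C y)" for l
  define k where "k l = f ((l + c) *\<^sub>C y) - f (l *\<^sub>C y)" for l
  have deriv: "(G has_field_derivative k l) (at l)" for l
  proof -
    define \<Phi> where "\<Phi> d = seg_integral f ((l + c) *\<^sub>C y) (d *\<^sub>C y) - seg_integral f (l *\<^sub>C y) (d *\<^sub>C y)" for d
    have quot: "(G (l + d) - G l) / d = \<Phi> d" if "d \<noteq> 0" for d
    proof -
      \<comment> \<open>In the parallelogram based at \<open>l y\<close>, the two sides in direction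
        \<open>c y\<close> contribute \<open>G l\<close> and \<open>- G (l + d)\<close>.\<close>
      have "para_integral c d (c *\<^sub>C y) (d *\<^sub>C y) (blowup 1 (l *\<^sub>C y) f) = 0"
        by (intro para_integral_eq_0 blowup_spectral_maps f) simp
      then have "G (l + d) - G l = d * \<Phi> d"
        by (simp add: para_integral_blowup[OF f] G_def \<Phi>_def scaleC_add_left algebra_simps)
      then show ?thesis
        using that by simp
    qed
    have bound: "cmod (\<Phi> d - k l) \<le> cmod d * (2 * norm y)" for d
      using seg_integral_approx[OF f, of "(l + c) *\<^sub>C y" "d *\<^sub>C y"]
        seg_integral_approx[OF f, of "l *\<^sub>C y" "d *\<^sub>C y"]
        norm_triangle_ineq4[of "seg_integral f ((l + c) *\<^sub>C y) (d *\<^sub>C y) - f ((l + c) *\<^sub>C y)"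
          "seg_integral f (l *\<^sub>C y) (d *\<^sub>C y) - f (l *\<^sub>C y)"]
      by (simp add: \<Phi>_def k_def norm_scaleC algebra_simps)
    have "((\<lambda>d. cmod d * (2 * norm y)) \<longlongrightarrow> 0) (at 0)"
      by (intro tendsto_eq_intros refl) auto
    then have "((\<lambda>d. \<Phi> d - k l) \<longlongrightarrow> 0) (at 0)"
      by (rule Lim_null_comparison[rotated]) (simp add: bound)
    then have "(\<Phi> \<longlongrightarrow> k l) (at 0)"
      by (rule LIM_zero_cancel)
    moreover have "\<forall>\<^sub>F d in at 0. \<Phi> d = (G (l + d) - G l) / d"
      by (auto simp: eventually_at_filter quot)
    ultimately show ?thesis
      unfolding DERIV_def by (rule Lim_transform_eventually)
  qed
  then have "G holomorphic_on UNIV"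
    by (auto simp: holomorphic_on_open)
  then have "deriv G holomorphic_on UNIV"
    by (rule holomorphic_deriv) simp
  moreover have "deriv G = k"
    using deriv by (auto intro: DERIV_imp_deriv)
  moreover have "bounded (range k)"
    unfolding bounded_iff
  proof (intro exI ballI)
    fix z
    assume "z \<in> range k"
    then obtain l where "z = k l"
      by auto
    then show "cmod z \<le> norm (c *\<^sub>C y)"
      using spectral_mapsD(4)[OF f, of "(l + c) *\<^sub>C y" "l *\<^sub>C y"] by (simp add: k_def scaleC_add_left)
  qed
  \<comment> \<open>The bound \<open>norm (c y)\<close> is independent of \<open>l\<close>, so
    Liouville's theorem applies to the entire function \<open>k\<close>.\<close>
  ultimately have "k constant_on UNIV"
    by (intro Liouville_theorem) simp_all
  then have "k l = k 0"
    by (auto simp: constant_on_def)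
  then show ?thesis
    by (simp add: k_def scaleC_zero_left spectral_mapsD(1)[OF f])
qed

text \<open>Natural multiples can be pulled out on lines through 0 and, after
  \<open>blowup 1 a\<close>, on lines through \<open>a\<close>. A defect \<open>e\<close> at
  \<open>y\<close> thus becomes \<open>n e\<close> at \<open>n y\<close>, while the Lipschitz bound
  keeps it within \<open>2 norm a\<close>.\<close>

lemma spectral_map_additive:
  assumes f: "f \<in> spectral_maps"
  shows "f (a + y) = f a + f y"
proof (rule ccontr)
  have mult: "g (real n *\<^sub>R y) = of_nat n * g y" if g: "g \<in> spectral_maps" for g and n :: nat
  proof (induction n)
    case (Suc n)
    have "g ((of_nat n + 1) *\<^sub>C y) - g (of_nat n *\<^sub>C y) = g y"
      using spectral_map_increment_const[OF g, of "of_nat n" 1 y] by (simp add: scaleC_one)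
    then show ?case
      using Suc.IH by (simp add: scaleR_scaleC algebra_simps)
  qed (simp add: spectral_mapsD(1)[OF g])
  define e where "e = f (a + y) - f a - f y"
  assume "f (a + y) \<noteq> f a + f y"
  then have "cmod e > 0"
    by (simp add: e_def algebra_simps)
  then obtain n where n: "real n * cmod e > norm a + norm a"
    using reals_Archimedean3 by blast
  have "f (a + real n *\<^sub>R y) - f a = of_nat n * (f (a + y) - f a)" "f (real n *\<^sub>R y) = of_nat n * f y"
    using mult[OF blowup_spectral_maps[OF f, of 1 a]] mult[OF f] by (simp_all add: blowup_def)
  then have "of_nat n * e = (f (a + real n *\<^sub>R y) - f (real n *\<^sub>R y)) - f a"
    by (simp add: e_def algebra_simps)
  then have "real n * cmod e \<le> cmod (f (a + real n *\<^sub>R y) - f (real n *\<^sub>R y)) + cmod (f a)"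
    by (metis norm_mult norm_of_nat norm_triangle_ineq4)
  also have "\<dots> \<le> norm a + norm a"
    using spectral_mapsD(4)[OF f, of "a + real n *\<^sub>R y" "real n *\<^sub>R y"] spectral_mapsD(5)[OF f, of a]
    by simp
  finally show False
    using n by simp
qed

theorem Kowalski_Slodkowski:
  assumes "f \<in> spectral_maps"
  shows "complex_linear f" "multiplicative f"
  using additive_spectral_map[OF assms] spectral_map_additive[OF assms] by blast+

section \<open>Reduction to spectral maps\<close>

text \<open>Dividing by \<open>g 1\<close> gives a map fixing 0 and 1. Distances to 0 and 1
  determine \<open>Re\<close> and \<open>|Im|\<close>; mutual distances determine products of
  imaginary parts, so the sign at \<open>\<i>\<close> decides everywhere.\<close>

lemma complex_isometry_cases:
  fixes g :: "complex \<Rightarrow> complex"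
  assumes g0: "g 0 = 0" and iso: "\<And>l m. cmod (g l - g m) = cmod (l - m)"
  shows "(\<forall>l. g l = g 1 * l) \<or> (\<forall>l. g l = g 1 * cnj l)"
proof -
  have a: "cmod (g 1) = 1"
    using iso[of 1 0] g0 by simp
  then have a1: "g 1 * cnj (g 1) = 1"
    by (simp add: complex_norm_square[symmetric])
  define h where "h l = cnj (g 1) * g l" for l
  have g_h: "g l = g 1 * h l" for l
    using a1 by (simp add: h_def flip: mult.assoc)
  have h_iso: "cmod (h l - h m) = cmod (l - m)" for l m
    using a iso[of l m] by (simp add: h_def norm_mult flip: right_diff_distrib)
  have h0: "h 0 = 0" and h1: "h 1 = 1"
    using a1 by (simp_all add: h_def g0 mult.commute)
  have sq: "(Re (h l - h m))\<^sup>2 + (Im (h l - h m))\<^sup>2 = (Re (l - m))\<^sup>2 + (Im (l - m))\<^sup>2" for l m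
    using h_iso[of l m] by (metis cmod_power2)
  have Re_h: "Re (h l) = Re l" and Im_h: "(Im (h l))\<^sup>2 = (Im l)\<^sup>2" for l
    using sq[of l 0] sq[of l 1] h0 h1 by (simp_all add: power2_eq_square algebra_simps)
  have prod: "Im (h l) * Im (h m) = Im l * Im m" for l m
    using sq[of l m] Im_h[of l] Im_h[of m] by (simp add: Re_h power2_eq_square algebra_simps)
  have "Im (h \<i>) = 1 \<or> Im (h \<i>) = -1"
    using Im_h[of \<i>] by (simp add: power2_eq_1_iff)
  then show ?thesis
  proof
    assume "Im (h \<i>) = 1"
    then have "h l = l" for l
      using prod[of l \<i>] Re_h[of l] by (simp add: complex_eq_iff)
    then show ?thesis
      using g_h by metis
  next
    assume "Im (h \<i>) = -1"
    then have "h l = cnj l" for l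
      using prod[of l \<i>] Re_h[of l] by (simp add: complex_eq_iff)
    then show ?thesis
      using g_h by metis
  qed
qed

theorem theorem1:
  fixes \<Delta> :: "'a::complex_unital_banach_algebra \<Rightarrow> complex"
  assumes "\<Delta> 0 = 0"
    and "\<And>x y. \<Delta> x - \<Delta> y \<in> circle_spectrum (x - y)"
  shows "(complex_linear \<Delta> \<or> conjugate_linear \<Delta>) \<and>
    multiplicative (\<lambda>a. cnj (\<Delta> 1) * \<Delta> a)"
proof -
  \<comment> \<open>Taking moduli removes the circle factor.\<close>
  have spec: "\<exists>z\<in>spectrum (x - y). cmod (\<Delta> x - \<Delta> y) = cmod z" for x y
    using assms(2)[of x y] by (auto simp: circle_spectrum_def norm_mult)
  have lip: "cmod (\<Delta> x - \<Delta> y) \<le> norm (x - y)" for x y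
    using spec[of x y] spectrum_norm_le by fastforce
  have iso: "cmod (\<Delta> (y + l *\<^sub>C 1) - \<Delta> (y + m *\<^sub>C 1)) = cmod (l - m)" for y l m
    using spec[of "y + l *\<^sub>C 1" "y + m *\<^sub>C 1"] in_spectrum_scaleC_one[of _ "l - m"]
    by (auto simp: scaleC_diff_left)
  define a where "a = \<Delta> 1"
  have a: "cmod a = 1"
    using iso[of 0 1 0] assms(1) by (simp add: a_def scaleC_one scaleC_zero_left)
  then have a1: "cnj a * a = 1"
    by (simp add: complex_norm_square[symmetric] mult.commute)
  define g where "g y l = \<Delta> (y + l *\<^sub>C 1) - \<Delta> y" for y l
  have g_cases: "(\<forall>l. g y l = g y 1 * l) \<or> (\<forall>l. g y l = g y 1 * cnj l)" for y
    by (rule complex_isometry_cases) (simp_all add: g_def scaleC_zero_left iso)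
  \<comment> \<open>Both alternatives respect natural multiples, so it need not be known which one
    holds at \<open>y\<close>.\<close>
  have g_scale: "g y (of_nat n * l) = of_nat n * g y l" for y n l
  proof -
    obtain \<alpha> where "(\<forall>l. g y l = \<alpha> * l) \<or> (\<forall>l. g y l = \<alpha> * cnj l)"
      using g_cases by blast
    then show ?thesis
      by (elim disjE) (simp_all add: mult.left_commute)
  qed
  \<comment> \<open>A discrepancy at \<open>l\<close> would grow like \<open>n\<close> at
    \<open>n l\<close>, but the Lipschitz bound keeps it within \<open>2 norm y\<close>.\<close>
  have shift: "g y l = g 0 l" for y l
  proof (rule ccontr)
    assume "g y l \<noteq> g 0 l"
    then have "cmod (g y l - g 0 l) > 0"
      by simp
    then obtain n where n: "real n * cmod (g y l - g 0 l) > norm y + norm y"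
      using reals_Archimedean3 by blast
    let ?m = "of_nat n * l"
    have "of_nat n * (g y l - g 0 l) = g y ?m - g 0 ?m"
      by (simp add: g_scale right_diff_distrib)
    also have "\<dots> = (\<Delta> (y + ?m *\<^sub>C 1) - \<Delta> (?m *\<^sub>C 1)) - (\<Delta> y - \<Delta> 0)"
      by (simp add: g_def)
    finally have "real n * cmod (g y l - g 0 l) = cmod \<dots>"
      by (metis norm_mult norm_of_nat)
    also have "\<dots> \<le> norm y + norm y"
      using lip[of "y + ?m *\<^sub>C 1" "?m *\<^sub>C 1"] lip[of y 0]
        norm_triangle_ineq4[of "\<Delta> (y + ?m *\<^sub>C 1) - \<Delta> (?m *\<^sub>C 1)" "\<Delta> y - \<Delta> 0"] by simp
    finally show False
      using n by simp
  qed
  have g01: "g 0 1 = a"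
    by (simp add: g_def a_def scaleC_one assms(1))
  have spectral: "f \<in> spectral_maps"
    if f: "\<And>y l. f (y + l *\<^sub>C 1) = f y + l" "\<And>x y. cmod (f x - f y) = cmod (\<Delta> x - \<Delta> y)" "f 0 = 0"
    for f :: "'a \<Rightarrow> complex"
  proof -
    have "f x - f y \<in> spectrum (x - y)" for x y
    proof -
      \<comment> \<open>Shifting \<open>x\<close> by \<open>w\<close> makes the two values of
        \<open>f\<close> equal, so the spectral value supplied by \<open>spec\<close> has modulus 0
        and is 0 itself; undoing the shift turns it into \<open>w\<close>.\<close>
      define w where "w = f x - f y"
      have "f (x - w *\<^sub>C 1) = f x - w"
        using f(1)[of x "- w"] by (simp add: scaleC_minus_left)
      then have "f (x - w *\<^sub>C 1) = f y"
        by (simp add: w_def)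
      then obtain z where "z \<in> spectrum (x - w *\<^sub>C 1 - y)" "cmod z = 0"
        using spec[of "x - w *\<^sub>C 1" y] f(2)[of "x - w *\<^sub>C 1" y] by auto
      then have "0 \<in> spectrum ((x - y) - w *\<^sub>C 1)"
        by (simp add: algebra_simps)
      then show ?thesis
        by (simp add: zero_in_spectrum_shift_iff w_def)
    qed
    then show ?thesis
      using f(3) by (simp add: spectral_maps_def)
  qed
  have translate: "\<Delta> (y + l *\<^sub>C 1) = \<Delta> y + g 0 l" for y l
    by (subst shift[of y l, symmetric]) (simp add: g_def)
  from g_cases[of 0, unfolded g01] show ?thesis
  proof
    assume *: "\<forall>l. g 0 l = a * l"
    define f where "f x = cnj a * \<Delta> x" for x
    have f_spectral: "f \<in> spectral_maps"
    proof (rule spectral)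
      show "f (y + l *\<^sub>C 1) = f y + l" for y l
        using * a1 by (simp add: f_def translate distrib_left flip: mult.assoc)
      show "cmod (f x - f y) = cmod (\<Delta> x - \<Delta> y)" for x y
        using a by (simp add: f_def norm_mult flip: right_diff_distrib)
    qed (simp add: f_def assms(1))
    have "\<Delta> x = a * f x" for x
      using a1 by (simp add: f_def mult.commute[of a] flip: mult.assoc)
    then have "complex_linear \<Delta>"
      using Kowalski_Slodkowski(1)[OF f_spectral] by (simp add: complex_linear_def distrib_left)
    moreover have "multiplicative (\<lambda>x. cnj (\<Delta> 1) * \<Delta> x)"
      using Kowalski_Slodkowski(2)[OF f_spectral] by (simp add: f_def[abs_def] a_def)
    ultimately show ?thesis
      by blast
  next
    assume *: "\<forall>l. g 0 l = a * cnj l"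
    \<comment> \<open>The outer conjugation turns \<open>a * cnj l\<close> into a plain shift by
      \<open>l\<close>, so \<open>spectral\<close> applies here too.\<close>
    define f where "f x = cnj (cnj a * \<Delta> x)" for x
    have f_spectral: "f \<in> spectral_maps"
    proof (rule spectral)
      show "f (y + l *\<^sub>C 1) = f y + l" for y l
      proof -
        have "cnj a * \<Delta> (y + l *\<^sub>C 1) = cnj a * \<Delta> y + (cnj a * a) * cnj l"
          using * by (simp add: translate distrib_left mult.assoc)
        then show ?thesis
          by (simp only: f_def a1 complex_cnj_add mult_1_left complex_cnj_cnj)
      qed
      show "cmod (f x - f y) = cmod (\<Delta> x - \<Delta> y)" for x y
      proof -
        have "f x - f y = cnj (cnj a * (\<Delta> x - \<Delta> y))"
          by (simp add: f_def right_diff_distrib)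
        then show ?thesis
          using a by (simp only: complex_mod_cnj norm_mult mult_1_left)
      qed
    qed (simp add: f_def assms(1))
    have cnj_f: "cnj a * \<Delta> x = cnj (f x)" for x
      by (simp add: f_def)
    have \<Delta>_f: "\<Delta> x = a * cnj (f x)" for x
      using a1 by (simp add: cnj_f[symmetric] mult.commute[of a] flip: mult.assoc)
    then have "conjugate_linear \<Delta>"
      using Kowalski_Slodkowski(1)[OF f_spectral]
      by (simp add: complex_linear_def conjugate_linear_def distrib_left)
    moreover have "multiplicative (\<lambda>x. cnj (\<Delta> 1) * \<Delta> x)"
      using Kowalski_Slodkowski(2)[OF f_spectral] by (simp add: multiplicative_def cnj_f flip: a_def)
    ultimately show ?thesis
      by blast
  qed
qed

end
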